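(* Let $n \geq 5000$ be an integer. Among all connected graphs on $n$ vertices, the maximum of the principal ratio is attained by a kite graph; that is, there exist positive integers $r, s$ with $r+s-1=n$ such that $\gamma(G) \leq \gamma(P_r\cdot K_s)$ for every connected graph $G$ on $n$ vertices.
   Context: All graphs are finite, simple and undirected. For a connected graph $G$ with adjacency matrix $A(G)$, let $\lambda_1(G)$ be the largest eigenvalue of $A(G)$. By Perron--Frobenius there is a unique positive unit eigenvector of $A(G)$ for $\lambda_1(G)$, called the principal eigenvector; let $x_{\min}$ and $x_{\max}$ be its smallest and largest entries. The principal ratio of $G$ is $\gamma(G) := x_{\max}/x_{\min}$ (it does not change if the eigenvector is rescaled by a positive constant). $P_r$ denotes the path on $r$ vertices and $K_s$ the complete graph on $s$ vertices. The kite graph $P_r\cdot K_s$ is the graph of order $r+s-1$ obtained by identifying an end vertex of $P_r$ with any vertex of $K_s$. *)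

theory Defs
  imports
    Complex_Main
    "Graph_Theory.Graph_Theory"
    "Jordan_Normal_Form.Spectral_Radius"
begin

text \<open>
  A finite simple undirected graph on \<open>n\<close> vertices is a \<open>pair_graph\<close> (finite, loop-free, symmetric
  set of arcs) with vertex set \<open>{0..<n}\<close>; the two arcs \<open>(u, v)\<close> and \<open>(v, u)\<close> together encode one
  undirected edge. The vertex names index the rows and columns of the adjacency matrix, so the
  definitions below are meant for graphs whose vertex set is an initial segment of the naturals.
\<close>

definition adjacency_matrix :: "nat pair_pre_digraph \<Rightarrow> real mat" where
  "adjacency_matrix G = mat (card (pverts G)) (card (pverts G))
     (\<lambda>(i, j). if (i, j) \<in> parcs G then 1 else 0)"

text \<open>
  The matrix is real symmetric, so its spectrum over the reals is its whole spectrum.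
\<close>

definition lambda1 :: "nat pair_pre_digraph \<Rightarrow> real" where
  "lambda1 G = Max (spectrum (adjacency_matrix G))"

text \<open>
  The description is well defined only for connected graphs (Perron--Frobenius).
\<close>

definition principal_eigenvector :: "nat pair_pre_digraph \<Rightarrow> real vec" where
  "principal_eigenvector G = (THE x. eigenvector (adjacency_matrix G) x (lambda1 G) \<and>
     (\<forall>i < dim_vec x. 0 < x $ i) \<and> x \<bullet> x = 1)"

definition principal_ratio :: "nat pair_pre_digraph \<Rightarrow> real" where
  "principal_ratio G =
     Max (vec_set (principal_eigenvector G)) / Min (vec_set (principal_eigenvector G))"

definition path_graph :: "nat \<Rightarrow> nat pair_pre_digraph" where
  "path_graph r = \<lparr>pverts = {0..<r},
     parcs = {(i, j). i < r \<and> j < r \<and> (j = Suc i \<or> i = Suc j)}\<rparr>"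

definition complete_graph_on :: "nat set \<Rightarrow> nat pair_pre_digraph" where
  "complete_graph_on V = \<lparr>pverts = V, parcs = {(i, j). i \<in> V \<and> j \<in> V \<and> i \<noteq> j}\<rparr>"

text \<open>
  The kite graph \<open>P\<^sub>r \<cdot> K\<^sub>s\<close>, meant for positive \<open>r\<close> and \<open>s\<close>: the \<open>s\<close> clique vertices are named
  \<open>r - 1, \<dots>, r + s - 2\<close>, so that the union identifies the end vertex \<open>r - 1\<close> of the path with a
  vertex of the clique and nothing else.
\<close>

definition kite_graph :: "nat \<Rightarrow> nat \<Rightarrow> nat pair_pre_digraph" where
  "kite_graph r s =
     (let P = path_graph r; K = complete_graph_on {r - 1..<r + s - 1}
      in \<lparr>pverts = pverts P \<union> pverts K, parcs = parcs P \<union> parcs K\<rparr>)"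

lemma pverts_kite_graph:
  assumes "0 < r" "0 < s"
  shows "pverts (kite_graph r s) = {0..<r + s - 1}"
  using assms by (auto simp: kite_graph_def path_graph_def complete_graph_on_def)

lemma pair_graph_kite_graph: "pair_graph (kite_graph r s)"
proof -
  have fin: "finite (pverts (kite_graph r s))"
    by (auto simp: kite_graph_def path_graph_def complete_graph_on_def Let_def)
  have sub: "parcs (kite_graph r s) \<subseteq> pverts (kite_graph r s) \<times> pverts (kite_graph r s)"
    by (auto simp: kite_graph_def path_graph_def complete_graph_on_def Let_def)
  have "sym (parcs (kite_graph r s))"
    by (auto simp: sym_def kite_graph_def path_graph_def complete_graph_on_def Let_def)
  then show ?thesis
    using sub fin finite_subset[OF sub]
    by unfold_locales
      (auto simp: symmetric_def kite_graph_def path_graph_def complete_graph_on_def Let_def)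
qed

lemma connected_kite_graph:
  assumes "0 < r" "0 < s"
  shows "Digraph_Component.connected (with_proj (kite_graph r s))"
proof -
  let ?G = "kite_graph r s"
  let ?M = "with_proj (mk_symmetric (with_proj ?G))"
  have arcs: "parcs ?G \<subseteq> parcs (mk_symmetric (with_proj ?G))"
    by (auto simp: mk_symmetric_def)
  have V: "pverts (mk_symmetric (with_proj ?G)) = {0..<r + s - 1}"
    using pverts_kite_graph[OF assms] by (simp add: mk_symmetric_def)
  interpret K: pair_graph ?G by (rule pair_graph_kite_graph)
  interpret M: pair_wf_digraph "mk_symmetric (with_proj ?G)" ..
  have adj: "reachable ?M u v" if "(u, v) \<in> parcs ?G" for u v
    using that arcs by (intro M.reachable_adjI) auto
  have step: "reachable ?M i (Suc i) \<and> reachable ?M (Suc i) i" if "Suc i < r + s - 1" for i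
  proof -
    have "(i, Suc i) \<in> parcs ?G \<and> (Suc i, i) \<in> parcs ?G"
      using that assms
      by (auto simp: kite_graph_def path_graph_def complete_graph_on_def Let_def)
    then show ?thesis using adj by blast
  qed
  have zero: "reachable ?M 0 i \<and> reachable ?M i 0" if "i < r + s - 1" for i
    using that
  proof (induction i)
    case 0
    then show ?case using V by (auto intro: M.reachable_refl)
  next
    case (Suc i)
    then show ?case using step[of i] by (meson M.reachable_trans Suc_lessD)
  qed
  have "reachable ?M u v" if "u < r + s - 1" "v < r + s - 1" for u v
    using zero[OF that(1)] zero[OF that(2)] M.reachable_trans by blast
  then show ?thesis
    unfolding Digraph_Component.connected_def strongly_connected_def
    using V assms by simp
qed

end

theory Submission
  imports Defs "HOL-Analysis.Function_Topology"
begin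

text \<open>
  Let \<open>K a\<close> be the kite on \<open>n\<close> vertices whose path has length \<open>a\<close>. Every connected graph \<open>G\<close> on
  \<open>n\<close> vertices is beaten by some \<open>K a\<close> with \<open>a\<close> depending on \<open>G\<close>; the best of the finitely many
  kites then beats all graphs, and nothing has to be known about which one it is.

  Let \<open>x\<close> be a Perron vector of \<open>G\<close> with eigenvalue \<open>\<lambda>\<close>, and let \<open>v 0, \<dots>, v d\<close> be a shortest path
  from a smallest entry to a largest entry. The eigenvalue equation gives
  \<open>x (v (k + 2)) \<le> \<lambda> x (v (k + 1)) - x (v k)\<close>, so the principal ratio is at most \<open>U d \<lambda>\<close>, where \<open>U\<close>
  are rescaled Chebyshev polynomials (\<open>cheb\<close>, \<open>end_le_cheb\<close>). For a kite this is attained: the ratio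
  of \<open>K a\<close> is at least \<open>U a\<close> at its own eigenvalue (\<open>cheb_le_ratio_kite\<close>). Hence \<open>G\<close> can only beat
  \<open>K d\<close> if \<open>\<lambda>\<close> exceeds the eigenvalue of \<open>K d\<close>.

  Let \<open>m = n - d - 1\<close> be the number of vertices outside the path. The clique of \<open>K d\<close> has \<open>m + 1\<close>
  vertices, so its eigenvalue is at least \<open>m\<close>, while \<open>\<lambda>\<close> is at most the degree of \<open>v d\<close>, which is at
  most \<open>m + 1\<close>. So a larger \<open>\<lambda>\<close> forces \<open>v d\<close> to be adjacent to all outside vertices, and since the path
  is shortest these see none of \<open>v 0, \<dots>, v (d - 3)\<close>. Three cases remain. If an outside vertex sees
  \<open>v (d - 2)\<close>, the ratio is at most \<open>U (d - 1) \<lambda>\<close> and \<open>K (d - 1)\<close> wins, because its eigenvalue is at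
  least \<open>m + 1\<close> (\<open>early_branch\<close>). If no outside vertex sees \<open>v (d - 2)\<close> or \<open>v (d - 1)\<close>, averaging
  over the outside shows that \<open>\<lambda>\<close> does not exceed the eigenvalue of \<open>K d\<close> after all (\<open>lam_le_kite\<close>).

  In the last case \<open>t \<ge> 1\<close> outside vertices see \<open>v (d - 1)\<close>. Normalise \<open>x (v d) = 1\<close> and put
  \<open>p = x (v (d - 1))\<close> and \<open>e = \<lambda> - m\<close>. Roughly \<open>p\<close> is \<open>(t + 1) / m\<close>, and \<open>e \<le> p\<^sup>2\<close>
  (\<open>excess_bounds\<close>). The ratio equals \<open>U (d - 1) \<lambda> / p\<close>, so \<open>K (d - 1)\<close> wins if raising the eigenvalue
  by \<open>1 - e\<close> over \<open>d - 1\<close> steps gains a factor \<open>1 / p\<close>; it also equals \<open>U d \<lambda> / S\<close> with \<open>S\<close> about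
  \<open>p m\<close>, so \<open>K d\<close> wins if lowering the eigenvalue by \<open>e\<close> over \<open>d\<close> steps loses no more than a factor
  \<open>S\<close>. With \<open>c = d / m\<close> these conditions read approximately \<open>c (1 - p\<^sup>2) \<ge> - ln p\<close> and
  \<open>c p\<^sup>2 \<le> ln m + ln p\<close>; one of them always holds because \<open>- ln p \<le> (1 - p\<^sup>2) ln m\<close> in the relevant
  range (\<open>growth_exponents_incompatible\<close>, \<open>late_branch\<close>).

  This needs \<open>d \<ge> 3\<close> and \<open>m \<ge> 35\<close>. Otherwise \<open>\<lambda> ^ d\<close> is a good enough bound on the ratio of \<open>G\<close>, and
  the kite with \<open>a = n div 2\<close> wins (\<open>balanced_kite_bounds\<close>).
\<close>

section \<open>Positive eigenvectors of symmetric adjacency relations\<close>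

lemma sum_adjacent_swap:
  fixes f :: "'a \<Rightarrow> 'a \<Rightarrow> 'b::comm_monoid_add"
  assumes "finite V" "E \<subseteq> V \<times> V" "sym E"
  shows "(\<Sum>i\<in>V. \<Sum>j\<in>E `` {i}. f i j) = (\<Sum>i\<in>V. \<Sum>j\<in>E `` {i}. f j i)"
proof -
  have fin: "finite (E `` {i})" for i
    using assms(1,2) by (meson finite_Image finite_SigmaI finite_subset finite.intros)
  have Sig: "Sigma V (\<lambda>i. E `` {i}) = E" using assms(2) by auto
  have "(\<Sum>i\<in>V. \<Sum>j\<in>E `` {i}. g i j) = (\<Sum>(i,j)\<in>E. g i j)" for g :: "'a \<Rightarrow> 'a \<Rightarrow> 'b"
    using sum.Sigma[of V "\<lambda>i. E `` {i}" g] fin assms(1) by (simp add: Sig)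
  moreover have "(\<Sum>(i,j)\<in>E. f i j) = (\<Sum>(i,j)\<in>E. f j i)"
    using assms(3)
    by (intro sum.reindex_bij_witness[of _ "\<lambda>(i,j). (j,i)" "\<lambda>(i,j). (j,i)"]) (auto dest: symD)
  ultimately show ?thesis by simp
qed

lemma compact_nonneg_unit_sphere:
  fixes V :: "'a set"
  assumes "finite V"
  shows "compact {f :: 'a \<Rightarrow> real. (\<forall>i. f i \<in> (if i \<in> V then {0..1} else {0})) \<and> (\<Sum>i\<in>V. (f i)\<^sup>2) = 1}"
proof -
  let ?B = "PiE UNIV (\<lambda>i. if i \<in> V then {0..1::real} else {0})"
  have "compactin (product_topology (\<lambda>i. euclidean) UNIV) ?B"
    by (subst compactin_PiE) auto
  then have "compact ?B"
    by (simp add: euclidean_product_topology)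
  moreover have "closed {f :: 'a \<Rightarrow> real. (\<Sum>i\<in>V. (f i)\<^sup>2) = 1}"
    by (intro closed_Collect_eq continuous_intros continuous_on_product_coordinates)
  ultimately have "compact (?B \<inter> {f. (\<Sum>i\<in>V. (f i)\<^sup>2) = 1})"
    by (rule compact_Int_closed)
  moreover have "?B \<inter> {f. (\<Sum>i\<in>V. (f i)\<^sup>2) = 1} =
      {f. (\<forall>i. f i \<in> (if i \<in> V then {0..1} else {0})) \<and> (\<Sum>i\<in>V. (f i)\<^sup>2) = 1}"
    by (simp add: PiE_UNIV_domain Pi_def Int_def)
  ultimately show ?thesis by simp
qed

text \<open>
  The Rayleigh quotient attains its maximum \<open>mu\<close> over the nonnegative part of the unit sphere at
  some \<open>f\<close>. Increasing a single coordinate of \<open>f\<close> stays in the nonnegative orthant, so the first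
  variation gives \<open>A f \<le> mu f\<close> coordinatewise; as \<open>f \<bullet> A f = mu (f \<bullet> f)\<close>, equality holds
  wherever \<open>f\<close> is positive, and where \<open>f\<close> vanishes both sides are \<open>0\<close>.
\<close>

lemma nonneg_eigenvector_exists:
  fixes V :: "'a set"
  assumes fin: "finite V" and ne: "V \<noteq> {}" and EV: "E \<subseteq> V \<times> V" and sym: "sym E"
  obtains f :: "'a \<Rightarrow> real" and mu where
    "\<And>i. 0 \<le> f i" "\<exists>i\<in>V. 0 < f i" "\<And>i. i \<in> V \<Longrightarrow> mu * f i = (\<Sum>j\<in>E `` {i}. f j)"
proof -
  define S where "S = {f :: 'a \<Rightarrow> real. (\<forall>i. f i \<in> (if i \<in> V then {0..1} else {0})) \<and> (\<Sum>i\<in>V. (f i)\<^sup>2) = 1}"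
  define Q where "Q = (\<lambda>f :: 'a \<Rightarrow> real. \<Sum>i\<in>V. \<Sum>j\<in>E `` {i}. f i * f j)"
  obtain i0 where i0: "i0 \<in> V" using ne by auto
  have finE: "finite (E `` {i})" for i
    using fin EV by (meson finite_Image finite_SigmaI finite_subset finite.intros)
  have EV': "j \<in> V" if "j \<in> E `` {i}" for i j using that EV by auto
  have comp: "compact S" unfolding S_def by (rule compact_nonneg_unit_sphere[OF fin])
  have "(\<Sum>i\<in>V. (if i = i0 then 1 else 0 :: real)\<^sup>2) = (\<Sum>i\<in>V. if i = i0 then 1 else 0)"
    by (intro sum.cong) auto
  also have "\<dots> = 1" using fin i0 by simp
  finally have "(\<lambda>i. if i = i0 then 1 else 0) \<in> S" using i0 by (auto simp: S_def)
  then have Sne: "S \<noteq> {}" by auto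
  have coord: "continuous_on S (\<lambda>f :: 'a \<Rightarrow> real. f i)" for i
    by (rule continuous_on_subset[OF continuous_on_product_coordinates]) auto
  have "continuous_on S Q" unfolding Q_def by (intro continuous_intros coord)
  from continuous_attains_sup[OF comp Sne this]
  obtain f where fS: "f \<in> S" and fmax: "\<And>g. g \<in> S \<Longrightarrow> Q g \<le> Q f" by auto
  define mu where "mu = Q f"
  have f0: "0 \<le> f i" for i using fS by (auto simp: S_def split: if_splits dest: spec[of _ i])
  have f1: "(\<Sum>i\<in>V. (f i)\<^sup>2) = 1" using fS by (simp add: S_def)
  have mu0: "0 \<le> mu" unfolding mu_def Q_def using f0 by (intro sum_nonneg mult_nonneg_nonneg) auto
  \<comment> \<open>By homogeneity the maximum on the sphere bounds the form on the whole nonnegative orthant.\<close>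
  have Qle: "Q g \<le> mu * (\<Sum>i\<in>V. (g i)\<^sup>2)" if g0: "\<And>i. 0 \<le> g i" for g
  proof (cases "(\<Sum>i\<in>V. (g i)\<^sup>2) = 0")
    case True
    then have "g i = 0" if "i \<in> V" for i
      using that fin by (simp add: sum_nonneg_eq_0_iff)
    then have "Q g = 0" unfolding Q_def by (intro sum.neutral) auto
    then show ?thesis using True by simp
  next
    case False
    define s where "s = (\<Sum>i\<in>V. (g i)\<^sup>2)"
    have s: "s > 0" using False unfolding s_def by (simp add: order_less_le sum_nonneg)
    define h where "h = (\<lambda>i. if i \<in> V then g i / sqrt s else 0)"
    have sq: "(h i)\<^sup>2 = (g i)\<^sup>2 / s" if "i \<in> V" for i
      using that s by (simp add: h_def power_divide)
    have hs: "(\<Sum>i\<in>V. (h i)\<^sup>2) = 1"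
      using s by (simp add: sq flip: sum_divide_distrib) (simp add: s_def)
    have "h i \<le> 1" if "i \<in> V" for i
    proof -
      have "(h i)\<^sup>2 \<le> (\<Sum>i\<in>V. (h i)\<^sup>2)" using that fin by (intro member_le_sum) auto
      then have "\<bar>h i\<bar> \<le> 1" unfolding hs abs_square_le_1 .
      then show ?thesis by simp
    qed
    then have "h \<in> S" using hs g0 s by (auto simp: S_def h_def)
    then have "Q h \<le> mu" using fmax mu_def by simp
    moreover have "Q h = Q g / s"
    proof -
      have "Q h = (\<Sum>i\<in>V. \<Sum>j\<in>E `` {i}. g i * g j / s)"
        unfolding Q_def using EV' s by (intro sum.cong refl) (auto simp: h_def)
      then show ?thesis by (simp add: Q_def sum_divide_distrib)
    qed
    ultimately show ?thesis using s by (simp add: s_def field_simps)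
  qed
  have le: "(\<Sum>j\<in>E `` {i}. f j) \<le> mu * f i" if i: "i \<in> V" for i
  proof (rule ccontr)
    assume neg: "\<not> ?thesis"
    define A where "A = (\<Sum>j\<in>E `` {i}. f j)"
    define eta where "eta = A - mu * f i"
    have eta: "eta > 0" using neg by (simp add: eta_def A_def)
    \<comment> \<open>The step length makes the second-order term \<open>mu * t\<^sup>2\<close> smaller than the first-order gain.\<close>
    define t where "t = eta / (mu + 1)"
    have t: "t > 0" using eta mu0 by (simp add: t_def)
    define e where "e = (\<lambda>j. if j = i then t else 0)"
    have e0: "0 \<le> e j" for j using t by (simp add: e_def)
    have ee: "(\<Sum>k\<in>V. e k * F k) = t * F i" for F
    proof -
      have "(\<Sum>k\<in>V. e k * F k) = (\<Sum>k\<in>V. if k = i then t * F k else 0)"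
        by (intro sum.cong) (auto simp: e_def)
      then show ?thesis using fin i by simp
    qed
    have "Q (\<lambda>j. f j + e j) = Q f + (\<Sum>k\<in>V. \<Sum>j\<in>E `` {k}. f k * e j)
        + (\<Sum>k\<in>V. \<Sum>j\<in>E `` {k}. e k * f j) + Q e"
      by (simp add: Q_def algebra_simps sum.distrib)
    also have "(\<Sum>k\<in>V. \<Sum>j\<in>E `` {k}. f k * e j) = (\<Sum>k\<in>V. \<Sum>j\<in>E `` {k}. e k * f j)"
      by (subst sum_adjacent_swap[OF fin EV sym]) (simp add: mult.commute)
    also have "(\<Sum>k\<in>V. \<Sum>j\<in>E `` {k}. e k * f j) = t * A"
      by (simp add: ee A_def flip: sum_distrib_left)
    finally have "Q (\<lambda>j. f j + e j) = mu + 2 * t * A + Q e" by (simp add: mu_def)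
    moreover have "0 \<le> Q e" unfolding Q_def using e0 by (intro sum_nonneg mult_nonneg_nonneg) auto
    moreover have "Q (\<lambda>j. f j + e j) \<le> mu * (\<Sum>k\<in>V. (f k + e k)\<^sup>2)"
      using f0 e0 by (intro Qle) simp
    moreover have "(\<Sum>k\<in>V. (f k + e k)\<^sup>2) = 1 + 2 * t * f i + t * t"
    proof -
      have "(\<Sum>k\<in>V. (f k + e k)\<^sup>2) = (\<Sum>k\<in>V. (f k)\<^sup>2) + 2 * (\<Sum>k\<in>V. e k * f k) + (\<Sum>k\<in>V. e k * e k)"
        by (simp add: power2_eq_square algebra_simps sum.distrib sum_distrib_left)
      then show ?thesis using f1 by (simp add: ee) (simp add: e_def)
    qed
    ultimately have "mu + 2 * t * A \<le> mu * (1 + 2 * t * f i + t * t)" by simp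
    then have "t * (2 * eta) \<le> t * (mu * t)" by (simp add: eta_def algebra_simps)
    then have "2 * eta \<le> mu * t" using t by simp
    also have "\<dots> \<le> eta"
      using mu0 eta by (simp add: t_def field_simps)
    finally show False using eta by simp
  qed
  have "(\<Sum>i\<in>V. f i * (mu * f i - (\<Sum>j\<in>E `` {i}. f j))) = mu * (\<Sum>i\<in>V. (f i)\<^sup>2) - Q f"
    by (simp add: Q_def algebra_simps sum_subtractf sum_distrib_left power2_eq_square)
  then have "(\<Sum>i\<in>V. f i * (mu * f i - (\<Sum>j\<in>E `` {i}. f j))) = 0"
    by (simp add: f1 mu_def)
  moreover have "0 \<le> f i * (mu * f i - (\<Sum>j\<in>E `` {i}. f j))" if "i \<in> V" for i
    using le[OF that] f0 by simp
  ultimately have zero: "f i * (mu * f i - (\<Sum>j\<in>E `` {i}. f j)) = 0" if "i \<in> V" for i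
    using that fin by (simp add: sum_nonneg_eq_0_iff)
  have "mu * f i = (\<Sum>j\<in>E `` {i}. f j)" if i: "i \<in> V" for i
  proof (cases "f i = 0")
    case True
    have "0 \<le> (\<Sum>j\<in>E `` {i}. f j)" using f0 by (intro sum_nonneg) auto
    then show ?thesis using le[OF i] True by simp
  next
    case False
    then show ?thesis using zero[OF i] by simp
  qed
  moreover have "\<exists>i\<in>V. 0 < f i"
  proof (rule ccontr)
    assume "\<not> ?thesis"
    then have "f i = 0" if "i \<in> V" for i using that f0[of i] by force
    then show False using f1 by simp
  qed
  ultimately show ?thesis using that f0 by blast
qed

locale perron =
  fixes V :: "'a set" and E :: "('a \<times> 'a) set" and x :: "'a \<Rightarrow> real" and lam :: real
  assumes finV: "finite V" and EV: "E \<subseteq> V \<times> V" and symE: "sym E" and irreflE: "irrefl E"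
    and pos: "i \<in> V \<Longrightarrow> 0 < x i"
    and eig: "i \<in> V \<Longrightarrow> lam * x i = (\<Sum>j\<in>E `` {i}. x j)"
begin

lemma nbhd_subset: "E `` {i} \<subseteq> V"
  using EV by auto

lemma finite_nbhd: "finite (E `` {i})"
  using finite_subset[OF nbhd_subset finV] .

text \<open>
  Pairing \<open>mu z \<le> A z\<close> with the positive eigenvector and moving the symmetric \<open>A\<close> to the other
  side gives \<open>mu (x \<bullet> z) \<le> lam (x \<bullet> z)\<close>. This is the source of all lower bounds on eigenvalues
  below: it suffices to exhibit a test vector \<open>z\<close>.
\<close>

lemma subinvariant_le:
  assumes z0: "\<And>i. i \<in> V \<Longrightarrow> 0 \<le> z i" and zpos: "\<exists>i\<in>V. 0 < z i"
    and sub: "\<And>i. i \<in> V \<Longrightarrow> mu * z i \<le> (\<Sum>j\<in>E `` {i}. z j)"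
  shows "mu \<le> lam"
proof -
  let ?s = "\<Sum>i\<in>V. x i * z i"
  obtain k where k: "k \<in> V" "0 < z k" using zpos by auto
  have "0 < x k * z k" using k pos by simp
  also have "\<dots> \<le> ?s" using k pos z0 finV
    by (intro member_le_sum) (auto intro!: mult_nonneg_nonneg simp: less_imp_le)
  finally have s: "0 < ?s" .
  have "mu * ?s = (\<Sum>i\<in>V. x i * (mu * z i))" by (simp add: sum_distrib_left algebra_simps)
  also have "\<dots> \<le> (\<Sum>i\<in>V. x i * (\<Sum>j\<in>E `` {i}. z j))"
    using pos sub by (intro sum_mono mult_left_mono) (auto simp: less_imp_le)
  also have "\<dots> = (\<Sum>i\<in>V. \<Sum>j\<in>E `` {i}. x i * z j)" by (simp add: sum_distrib_left)
  also have "\<dots> = (\<Sum>i\<in>V. \<Sum>j\<in>E `` {i}. x j * z i)"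
    by (rule sum_adjacent_swap[OF finV EV symE])
  also have "\<dots> = (\<Sum>i\<in>V. lam * x i * z i)"
    by (intro sum.cong) (auto simp: eig sum_distrib_right)
  also have "\<dots> = lam * ?s" by (simp add: sum_distrib_left algebra_simps)
  finally show ?thesis using s by simp
qed

lemma scale: "0 < c \<Longrightarrow> perron V E (\<lambda>i. c * x i) lam"
  using finV EV symE irreflE pos eig
  by unfold_locales (auto simp: mult.left_commute eig[symmetric] sum_distrib_left[symmetric])

lemma eigenvalue_le:
  assumes y: "\<And>i. i \<in> V \<Longrightarrow> mu * y i = (\<Sum>j\<in>E `` {i}. y j)" and nz: "\<exists>i\<in>V. y i \<noteq> 0"
  shows "mu \<le> lam"
proof (rule subinvariant_le[of "\<lambda>i. \<bar>y i\<bar>"])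
  show "mu * \<bar>y i\<bar> \<le> (\<Sum>j\<in>E `` {i}. \<bar>y j\<bar>)" if "i \<in> V" for i
  proof -
    have "mu * \<bar>y i\<bar> \<le> \<bar>mu * y i\<bar>" by (simp add: abs_mult mult_right_mono)
    also have "\<dots> \<le> (\<Sum>j\<in>E `` {i}. \<bar>y j\<bar>)" unfolding y[OF that] by (rule sum_abs)
    finally show ?thesis .
  qed
qed (use nz in auto)

end

text \<open>
  At a zero of a nonnegative eigenvector the neighbours sum to zero, so zeros spread along edges.
\<close>

lemma nonneg_eigenvector_pos:
  fixes f :: "'a \<Rightarrow> real"
  assumes fin: "finite V" and EV: "E \<subseteq> V \<times> V"
    and conn: "\<And>i j. i \<in> V \<Longrightarrow> j \<in> V \<Longrightarrow> (i, j) \<in> E\<^sup>*"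
    and f0: "\<And>i. i \<in> V \<Longrightarrow> 0 \<le> f i" and fpos: "\<exists>i\<in>V. 0 < f i"
    and eig: "\<And>i. i \<in> V \<Longrightarrow> mu * f i = (\<Sum>j\<in>E `` {i}. f j)" and i: "i \<in> V"
  shows "0 < f i"
proof (rule ccontr)
  assume "\<not> ?thesis"
  then have fi: "f i = 0" using f0[OF i] by simp
  have "f j = 0 \<and> j \<in> V" if "(i, j) \<in> E\<^sup>*" for j
    using that
  proof induction
    case base
    then show ?case using fi i by simp
  next
    case (step j k)
    have "finite (E `` {j})" using fin EV by (meson finite_Image finite_SigmaI finite_subset finite.intros)
    moreover have "(\<Sum>j\<in>E `` {j}. f j) = 0" using eig[of j] step by simp
    moreover have "\<And>k. k \<in> E `` {j} \<Longrightarrow> 0 \<le> f k" using f0 EV by auto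
    ultimately have "\<forall>k\<in>E `` {j}. f k = 0" by (meson sum_nonneg_eq_0_iff)
    then show ?case using step EV by auto
  qed
  then show False using fpos conn[OF i] by force
qed

lemma perron_exists:
  fixes V :: "'a set"
  assumes fin: "finite V" and ne: "V \<noteq> {}" and EV: "E \<subseteq> V \<times> V" and sym: "sym E" and irr: "irrefl E"
    and conn: "\<And>i j. i \<in> V \<Longrightarrow> j \<in> V \<Longrightarrow> (i, j) \<in> E\<^sup>*"
  obtains x lam where "perron V E x lam"
proof -
  obtain f mu where f: "\<And>i. 0 \<le> f i" "\<exists>i\<in>V. 0 < f i"
      "\<And>i. i \<in> V \<Longrightarrow> mu * f i = (\<Sum>j\<in>E `` {i}. f j :: real)"
    using nonneg_eigenvector_exists[OF fin ne EV sym] by metis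
  have "perron V E f mu"
    using fin EV sym irr f nonneg_eigenvector_pos[OF fin EV conn f(1) f(2) f(3)]
    by unfold_locales auto
  then show ?thesis using that by blast
qed

text \<open>
  Subtract from \<open>y\<close> the largest multiple of \<open>x\<close> that keeps it nonnegative: the difference is an
  eigenvector with a zero, so it cannot have a positive entry.
\<close>

lemma perron_proportional:
  fixes V :: "'a set"
  assumes ne: "V \<noteq> {}" and conn: "\<And>i j. i \<in> V \<Longrightarrow> j \<in> V \<Longrightarrow> (i, j) \<in> E\<^sup>*"
    and "perron V E x lam" "perron V E y lam"
  obtains c where "0 < c" "\<And>i. i \<in> V \<Longrightarrow> y i = c * x i"
proof -
  interpret X: perron V E x lam by fact
  interpret Y: perron V E y lam by fact
  define c where "c = Min ((\<lambda>i. y i / x i) ` V)"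
  have "c \<in> (\<lambda>i. y i / x i) ` V" unfolding c_def using X.finV ne by (intro Min_in) auto
  then obtain k where k: "k \<in> V" "c = y k / x k" by auto
  have cle: "c * x i \<le> y i" if "i \<in> V" for i
  proof -
    have "c \<le> y i / x i" unfolding c_def using X.finV that by (intro Min_le) auto
    then show ?thesis using X.pos[OF that] by (simp add: field_simps)
  qed
  have "y i = c * x i" if "i \<in> V" for i
  proof (rule ccontr)
    assume "y i \<noteq> c * x i"
    then have "0 < y i - c * x i" using cle[OF that] by simp
    then have some: "\<exists>i\<in>V. 0 < y i - c * x i" using that by blast
    have "lam * (y j - c * x j) = (\<Sum>l\<in>E `` {j}. y l - c * x l)" if "j \<in> V" for j
    proof -
      have "(\<Sum>l\<in>E `` {j}. y l - c * x l) = lam * y j - c * (lam * x j)"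
        by (simp add: sum_subtractf X.eig[OF that] Y.eig[OF that] sum_distrib_left)
      then show ?thesis by (simp add: algebra_simps)
    qed
    then have "0 < y k - c * x k"
      using nonneg_eigenvector_pos[OF X.finV X.EV conn _ some _ k(1), of lam] cle by simp
    then show False using k X.pos[of k] by simp
  qed
  moreover have "c > 0" using k X.pos Y.pos by simp
  ultimately show ?thesis using that by blast
qed

section \<open>The principal ratio of a connected graph\<close>

lemma adjacency_matrix_mult_vec:
  assumes V: "pverts G = {0..<n}" and EV: "parcs G \<subseteq> {0..<n} \<times> {0..<n}"
    and v: "v \<in> carrier_vec n" and i: "i < n"
  shows "(adjacency_matrix G *\<^sub>v v) $ i = (\<Sum>j\<in>parcs G `` {i}. v $ j)"
proof -
  have "(adjacency_matrix G *\<^sub>v v) $ i = (\<Sum>j\<in>{0..<n}. (if (i, j) \<in> parcs G then 1 else 0) * v $ j)"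
    using V v i by (simp add: adjacency_matrix_def scalar_prod_def carrier_vecD)
  also have "\<dots> = (\<Sum>j\<in>{0..<n}. if j \<in> parcs G `` {i} then v $ j else 0)"
    by (intro sum.cong) auto
  also have "\<dots> = (\<Sum>j\<in>{0..<n} \<inter> parcs G `` {i}. v $ j)"
    by (simp add: sum.inter_restrict)
  also have "{0..<n} \<inter> parcs G `` {i} = parcs G `` {i}" using EV by auto
  finally show ?thesis .
qed

lemma eigenvector_adjacency_matrix_iff:
  assumes V: "pverts G = {0..<n}" and EV: "parcs G \<subseteq> {0..<n} \<times> {0..<n}"
  shows "eigenvector (adjacency_matrix G) v k \<longleftrightarrow>
    v \<in> carrier_vec n \<and> (\<exists>i\<in>{0..<n}. v $ i \<noteq> 0) \<and>
    (\<forall>i\<in>{0..<n}. k * v $ i = (\<Sum>j\<in>parcs G `` {i}. v $ j))"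
proof -
  have dim: "dim_row (adjacency_matrix G) = n" using V by (simp add: adjacency_matrix_def)
  have nz: "v \<noteq> 0\<^sub>v n \<longleftrightarrow> (\<exists>i\<in>{0..<n}. v $ i \<noteq> 0)" if "v \<in> carrier_vec n"
    using that by (auto simp: vec_eq_iff)
  have "adjacency_matrix G *\<^sub>v v = k \<cdot>\<^sub>v v \<longleftrightarrow>
      (\<forall>i\<in>{0..<n}. k * v $ i = (\<Sum>j\<in>parcs G `` {i}. v $ j))" if v: "v \<in> carrier_vec n"
  proof -
    have "adjacency_matrix G *\<^sub>v v = k \<cdot>\<^sub>v v \<longleftrightarrow>
        (\<forall>i<n. (adjacency_matrix G *\<^sub>v v) $ i = (k \<cdot>\<^sub>v v) $ i)"
      using v dim by (auto simp: vec_eq_iff)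
    then show ?thesis
      using v adjacency_matrix_mult_vec[OF V EV v] by auto
  qed
  then show ?thesis using nz unfolding eigenvector_def dim by blast
qed

lemma connected_rtrancl:
  assumes G: "pair_graph G" and conn: "Digraph_Component.connected (with_proj G)"
    and ij: "i \<in> pverts G" "j \<in> pverts G"
  shows "(i, j) \<in> (parcs G)\<^sup>*"
proof -
  interpret G: pair_graph G by (rule G)
  have "(i, j) \<in> rtrancl_on (pverts G) (parcs (mk_symmetric (with_proj G)))"
    using conn ij by (auto simp: Digraph_Component.connected_def strongly_connected_def reachable_def)
  moreover have "parcs (mk_symmetric (with_proj G)) = parcs G"
    using G.pair_sym_arcs by (auto simp: parcs_mk_symmetric symmetric_def dest: symD)
  ultimately show ?thesis by (metis rtrancl_on_rtranclI)
qed

text \<open>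
  From here on matrices disappear: the principal ratio is read off from any positive solution of
  the eigenvalue equation over neighbourhoods.
\<close>

lemma principal_ratio_perron:
  assumes G: "pair_graph G" and conn: "Digraph_Component.connected (with_proj G)"
    and V: "pverts G = {0..<n}"
  obtains x where "perron {0..<n} (parcs G) x (lambda1 G)"
    and "principal_ratio G = Max (x ` {0..<n}) / Min (x ` {0..<n})"
proof -
  interpret G: pair_graph G by (rule G)
  let ?E = "parcs G" and ?V = "{0..<n}" and ?A = "adjacency_matrix G"
  have EV: "?E \<subseteq> ?V \<times> ?V" using G.in_arcsD1 G.in_arcsD2 V by auto
  have symE: "sym ?E" using G.pair_sym_arcs by (simp add: symmetric_def)
  have irr: "irrefl ?E" using G.pair_no_loops by (force simp: irrefl_def)
  have ne: "?V \<noteq> {}"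
    using conn V by (simp add: Digraph_Component.connected_def strongly_connected_def)
  note rt = connected_rtrancl[OF G conn, unfolded V]
  obtain y lam where y: "perron ?V ?E y lam"
    using perron_exists[OF _ ne EV symE irr rt] by auto
  interpret Y: perron ?V ?E y lam by (rule y)
  define s where "s = (\<Sum>i\<in>?V. (y i)\<^sup>2)"
  have s: "0 < s" unfolding s_def using ne by (intro sum_pos zero_less_power Y.pos) auto
  define x where "x = (\<lambda>i. inverse (sqrt s) * y i)"
  have x: "perron ?V ?E x lam" unfolding x_def using s by (intro Y.scale) simp
  interpret X: perron ?V ?E x lam by (rule x)
  have unit: "(\<Sum>i\<in>?V. x i * x i) = 1"
  proof -
    have "(\<Sum>i\<in>?V. x i * x i) = (\<Sum>i\<in>?V. (y i)\<^sup>2 / s)"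
      using s by (intro sum.cong) (auto simp: x_def field_simps power2_eq_square)
    also have "\<dots> = 1" using s by (simp add: s_def flip: sum_divide_distrib)
    finally show ?thesis .
  qed
  note ev = eigenvector_adjacency_matrix_iff[OF V EV]
  have A: "?A \<in> carrier_mat n n" using V by (simp add: adjacency_matrix_def)
  have nz: "\<exists>i\<in>?V. x i \<noteq> 0" using ne X.pos by force
  have sumvec: "(\<Sum>j\<in>?E `` {i}. vec n x $ j) = (\<Sum>j\<in>?E `` {i}. x j)" for i
    using EV by (intro sum.cong) auto
  have evx: "eigenvector ?A (vec n x) lam"
    unfolding ev sumvec using nz X.eig by auto
  have lam: "lambda1 G = lam"
    unfolding lambda1_def
  proof (rule Max_eqI)
    show "finite (spectrum ?A)" by (rule card_finite_spectrum(1)[OF A])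
    show "lam \<in> spectrum ?A" using evx by (auto simp: spectrum_def eigenvalue_def)
    show "k \<le> lam" if k: "k \<in> spectrum ?A" for k
    proof -
      obtain v where "eigenvector ?A v k" using k by (auto simp: spectrum_def eigenvalue_def)
      then show ?thesis using X.eigenvalue_le[of k "\<lambda>i. v $ i"] unfolding ev by blast
    qed
  qed
  have "principal_eigenvector G = vec n x"
    unfolding principal_eigenvector_def lam
  proof (rule the_equality)
    show "eigenvector ?A (vec n x) lam \<and> (\<forall>i < dim_vec (vec n x). 0 < vec n x $ i) \<and> vec n x \<bullet> vec n x = 1"
      using evx X.pos unit by (simp add: scalar_prod_def)
    fix v assume v: "eigenvector ?A v lam \<and> (\<forall>i < dim_vec v. 0 < v $ i) \<and> v \<bullet> v = 1"
    then have vc: "v \<in> carrier_vec n" unfolding ev by blast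
    then have dv: "dim_vec v = n" by simp
    have "perron ?V ?E (\<lambda>i. v $ i) lam"
      using v EV symE irr unfolding ev dv by unfold_locales auto
    then obtain c where c: "0 < c" "\<And>i. i \<in> ?V \<Longrightarrow> v $ i = c * x i"
      using perron_proportional[OF ne rt x] by metis
    have "1 = (\<Sum>i\<in>?V. v $ i * v $ i)" using v dv by (simp add: scalar_prod_def)
    also have "\<dots> = c * c * (\<Sum>i\<in>?V. x i * x i)"
      unfolding sum_distrib_left by (intro sum.cong) (auto simp: c)
    finally have "c * c = 1" using unit by simp
    then have "c = 1" using c(1) by (simp add: square_eq_1_iff)
    then show "v = vec n x" using c dv by (intro eq_vecI) auto
  qed
  then have "vec_set (principal_eigenvector G) = x ` ?V"
    by (auto simp: vec_set_def)
  then show ?thesis using that x unfolding lam principal_ratio_def by simp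
qed

section \<open>Chebyshev growth\<close>

text \<open>
  The Chebyshev polynomials of the second kind in the variable \<open>t / 2\<close>, that is
  \<open>cheb k (2 * cos \<theta>) = sin ((k + 1) * \<theta>) / sin \<theta>\<close>.
\<close>

fun cheb :: "nat \<Rightarrow> real \<Rightarrow> real" where
  "cheb 0 t = 1"
| "cheb (Suc 0) t = t"
| "cheb (Suc (Suc k)) t = t * cheb (Suc k) t - cheb k t"

lemma cheb_growth:
  assumes "2 \<le> t"
  shows "0 < cheb k t \<and> (t - 1) * cheb k t \<le> cheb (Suc k) t"
proof (induction k)
  case 0
  then show ?case by simp
next
  case (Suc k)
  have "1 * cheb k t \<le> (t - 1) * cheb k t" using Suc assms by (intro mult_right_mono) auto
  then have "cheb k t \<le> cheb (Suc k) t" "0 < cheb (Suc k) t" using Suc by linarith+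
  then show ?case by (simp add: algebra_simps)
qed

lemma cheb_pos: "2 \<le> t \<Longrightarrow> 0 < cheb k t"
  using cheb_growth by blast

lemma cheb_le_Suc:
  assumes "2 \<le> t" shows "cheb k t \<le> cheb (Suc k) t"
proof -
  have "1 * cheb k t \<le> (t - 1) * cheb k t"
    using assms cheb_pos[OF assms, of k] by (intro mult_right_mono) auto
  then show ?thesis using cheb_growth[OF assms, of k] by linarith
qed

lemma power_le_cheb:
  assumes "2 \<le> t"
  shows "(t - 1) ^ k \<le> cheb k t"
proof (induction k)
  case (Suc k)
  have "(t - 1) ^ Suc k \<le> (t - 1) * cheb k t" using Suc assms by simp
  then show ?case using cheb_growth[OF assms, of k] by linarith
qed simp

text \<open>
  All zeros of \<open>cheb k\<close> lie symmetrically in \<open>(-2, 2)\<close>. By symmetry \<open>cheb k t / t ^ k\<close> is a product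
  of factors \<open>1 - (c / t)\<^sup>2\<close>, hence increasing for \<open>t \<ge> 2\<close>; and \<open>cheb k t / (t - 2) ^ k\<close> is a product
  of factors \<open>(t - c) / (t - 2)\<close> with \<open>c < 2\<close>, hence decreasing. Both facts are proved without
  zeros, by induction on the quotient of consecutive polynomials, which satisfies
  \<open>R (k + 1) t = t - 1 / R k t\<close>. They convert a change of eigenvalue into a change of ratio.
\<close>

lemma cheb_ratio_mono:
  assumes "2 \<le> a" "a \<le> b"
  shows "b * cheb (Suc k) a * cheb k b \<le> a * cheb (Suc k) b * cheb k a"
proof (induction k)
  case 0
  then show ?case by simp
next
  case (Suc k)
  have b2: "2 \<le> b" using assms by simp
  note pos = cheb_pos[OF assms(1)] cheb_pos[OF b2]
  have "a * (cheb k b * cheb (Suc k) a) \<le> b * (cheb k b * cheb (Suc k) a)"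
    using assms pos by (intro mult_right_mono) (auto simp: less_imp_le)
  also have "\<dots> \<le> a * (cheb (Suc k) b * cheb k a)"
    using Suc by (simp add: algebra_simps)
  also have "\<dots> \<le> b * (cheb (Suc k) b * cheb k a)"
    using assms pos by (intro mult_right_mono) (auto simp: less_imp_le)
  finally show ?case by (simp add: algebra_simps)
qed

lemma cheb_power_mono:
  assumes "2 \<le> a" "a \<le> b"
  shows "b ^ k * cheb k a \<le> a ^ k * cheb k b"
proof (induction k)
  case (Suc k)
  have b2: "2 \<le> b" using assms by simp
  note pos = cheb_pos[OF assms(1)] cheb_pos[OF b2]
  have "b ^ Suc k * cheb (Suc k) a * cheb k b = b ^ k * (b * cheb (Suc k) a * cheb k b)"
    by simp
  also have "\<dots> \<le> b ^ k * (a * cheb (Suc k) b * cheb k a)"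
    using cheb_ratio_mono[OF assms] b2 by (intro mult_left_mono) auto
  also have "\<dots> = a * cheb (Suc k) b * (b ^ k * cheb k a)" by simp
  also have "\<dots> \<le> a * cheb (Suc k) b * (a ^ k * cheb k b)"
    using Suc pos assms by (intro mult_left_mono) (auto intro!: mult_nonneg_nonneg simp: less_imp_le)
  finally have "b ^ Suc k * cheb (Suc k) a * cheb k b \<le> a ^ Suc k * cheb (Suc k) b * cheb k b"
    by (simp add: algebra_simps)
  then show ?case using pos(2)[of k] by (simp only: mult_le_cancel_right_pos)
qed simp

lemma cheb_mono:
  assumes "2 \<le> a" "a \<le> b"
  shows "cheb k a \<le> cheb k b"
proof -
  have "b ^ k * cheb k a \<le> a ^ k * cheb k b" by (rule cheb_power_mono[OF assms])
  also have "\<dots> \<le> b ^ k * cheb k b"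
    using assms cheb_pos[of b k] by (intro mult_right_mono power_mono) auto
  finally show ?thesis using assms by simp
qed

lemma cheb_ratio_antimono:
  assumes "2 \<le> a" "a \<le> b"
  shows "(a - 2) * cheb (Suc k) b * cheb k a \<le> (b - 2) * cheb (Suc k) a * cheb k b"
proof (induction k)
  case 0
  then show ?case using assms by (simp add: algebra_simps)
next
  case (Suc k)
  have b2: "2 \<le> b" using assms by simp
  define A0 A1 B0 B1 where "A0 = cheb k a" and "A1 = cheb (Suc k) a"
    and "B0 = cheb k b" and "B1 = cheb (Suc k) b"
  note defs = A0_def A1_def B0_def B1_def
  have pos: "0 < A0" "0 < A1" "0 < B0" "0 < B1" and le: "A0 \<le> A1" "B0 \<le> B1"
    using cheb_pos cheb_le_Suc assms(1) b2 by (simp_all add: defs)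
  have IH: "(a - 2) * (A0 * B1) \<le> (b - 2) * (A1 * B0)"
    using Suc by (simp add: defs algebra_simps)
  have "(b - 2) * (A0 * B1) - (a - 2) * (A1 * B0) \<le> (b - a) * (A1 * B0 + A0 * B1)"
    using IH by (simp add: algebra_simps)
  also have "\<dots> \<le> (b - a) * (A1 * B1 + A1 * B1)"
    using assms pos le by (intro mult_left_mono add_mono mult_mono) (auto simp: less_imp_le)
  finally have "(a - 2) * (b * B1 - B0) * A1 \<le> (b - 2) * (a * A1 - A0) * B1"
    by (simp add: algebra_simps)
  then show ?case by (simp add: defs)
qed

lemma cheb_power_antimono:
  assumes "2 \<le> a" "a \<le> b"
  shows "(a - 2) ^ k * cheb k b \<le> (b - 2) ^ k * cheb k a"
proof (induction k)
  case (Suc k)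
  have b2: "2 \<le> b" using assms by simp
  note pos = cheb_pos[OF assms(1)] cheb_pos[OF b2]
  have "(a - 2) ^ Suc k * cheb (Suc k) b * cheb k a = (a - 2) ^ k * ((a - 2) * cheb (Suc k) b * cheb k a)"
    by simp
  also have "\<dots> \<le> (a - 2) ^ k * ((b - 2) * cheb (Suc k) a * cheb k b)"
    using cheb_ratio_antimono[OF assms] assms by (intro mult_left_mono) auto
  also have "\<dots> = (b - 2) * cheb (Suc k) a * ((a - 2) ^ k * cheb k b)" by simp
  also have "\<dots> \<le> (b - 2) * cheb (Suc k) a * ((b - 2) ^ k * cheb k a)"
    using Suc pos b2 by (intro mult_left_mono) (auto intro!: mult_nonneg_nonneg simp: less_imp_le)
  finally have "(a - 2) ^ Suc k * cheb (Suc k) b * cheb k a \<le> (b - 2) ^ Suc k * cheb (Suc k) a * cheb k a"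
    by (simp add: algebra_simps)
  then show ?case using pos(1)[of k] by (simp only: mult_le_cancel_right_pos)
qed simp

lemma recurrence_eq_cheb:
  fixes y :: "nat \<Rightarrow> real"
  assumes "1 \<le> d \<Longrightarrow> y 1 = t * y 0"
    and "\<And>k. k + 2 \<le> d \<Longrightarrow> y (k + 2) = t * y (k + 1) - y k" and "k \<le> d"
  shows "y k = cheb k t * y 0"
  using assms(3)
proof (induction k rule: less_induct)
  case (less k)
  consider "k = 0" | "k = 1" | j where "k = Suc (Suc j)" by (metis One_nat_def not0_implies_Suc)
  then show ?case
  proof cases
    case 3
    then have "y j = cheb j t * y 0" "y (Suc j) = cheb (Suc j) t * y 0" 
      using less.IH[of j] less.IH[of "Suc j"] less.prems 3 by simp_all
    moreover have "y (Suc (Suc j)) = t * y (Suc j) - y j" using less.prems 3 assms(2)[of j] by simp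
    ultimately show ?thesis using 3 by (simp add: algebra_simps)
  qed (use less assms(1) in auto)
qed

lemma recurrence_le_cheb:
  fixes y :: "nat \<Rightarrow> real"
  assumes t: "2 \<le> t" and y1: "1 \<le> d \<Longrightarrow> y 1 \<le> t * y 0"
    and y2: "\<And>k. k + 2 \<le> d \<Longrightarrow> y (k + 2) \<le> t * y (k + 1) - y k" and "k \<le> d"
  shows "y k \<le> cheb k t * y 0"
proof -
  have step: "y (Suc k) * cheb k t \<le> cheb (Suc k) t * y k" if "Suc k \<le> d" for k
    using that
  proof (induction k)
    case 0
    then show ?case using y1 by simp
  next
    case (Suc k)
    have "y (Suc (Suc k)) * cheb (Suc k) t \<le> (t * y (Suc k) - y k) * cheb (Suc k) t"
      using y2[of k] Suc.prems cheb_pos[OF t] by (intro mult_right_mono) (auto simp: less_imp_le)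
    also have "\<dots> \<le> (t * cheb (Suc k) t - cheb k t) * y (Suc k)"
      using Suc by (simp add: algebra_simps)
    finally show ?case by simp
  qed
  show ?thesis using \<open>k \<le> d\<close>
  proof (induction k)
    case (Suc k)
    have "y (Suc k) * cheb k t \<le> cheb (Suc k) t * y k" using step Suc.prems by simp
    also have "\<dots> \<le> cheb (Suc k) t * (cheb k t * y 0)"
      using Suc cheb_pos[OF t, of "Suc k"] by (intro mult_left_mono) auto
    finally have "y (Suc k) * cheb k t \<le> (cheb (Suc k) t * y 0) * cheb k t" by (simp add: algebra_simps)
    then show ?case using cheb_pos[OF t, of k] by (simp only: mult_le_cancel_right_pos)
  qed simp
qed

text \<open>
  With \<open>L = - ln p\<close>, hypothesis \<open>A\<close> bounds \<open>k\<close> from above by about \<open>m L / (1 - e)\<close> and hypothesis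
  \<open>B\<close> bounds it from below by about \<open>m (ln m - L) / e\<close>. Eliminating \<open>k\<close> leaves
  \<open>(1 - e) ln m < L\<close> up to lower-order terms. But \<open>e \<le> p\<^sup>2\<close>, and \<open>- ln p\<close> stays below
  \<open>(1 - p\<^sup>2) ln m\<close> for \<open>p\<close> between \<open>2 / (m + 2)\<close> and \<open>1\<close>: the two functions only meet near
  \<open>p = 1 / m\<close> and at \<open>p = 1\<close>. The margin is smallest at the left end, where it is about \<open>ln 2\<close>.
\<close>

lemma growth_exponents_incompatible:
  fixes m p e k S :: real
  assumes m: "35 \<le> m" and p: "0 < p" "p < 1" and e: "0 \<le> e" "e \<le> p\<^sup>2"
    and p2: "2 \<le> (m + 2) * p" and S: "p * (m - 1) \<le> S"
    and A: "k * (1 - e) < (m + 1) * - ln p"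
    and B: "ln S * (m - 2) < (k + 1) * e"
  shows False
proof -
  define L where "L = - ln p"
  define G where "G = ln (m - 1)"
  define M where "M = m - 2"
  have M: "33 \<le> M" using m by (simp add: M_def)
  have L0: "0 < L" using p by (simp add: L_def)
  have e1: "e < 1" using e p by (smt (verit) power2_eq_square mult_less_cancel_left2 mult_le_one)
  have "G - L = ln (p * (m - 1))" using p m by (simp add: G_def L_def ln_mult)
  also have "\<dots> \<le> ln S"
  proof -
    have "0 < p * (m - 1)" using p m by simp
    then show ?thesis using S by simp
  qed
  finally have GL: "G - L \<le> ln S" .
  have "(G - L) * M * (1 - e) \<le> ln S * M * (1 - e)"
    using GL M e1 by (intro mult_right_mono) auto
  also have "\<dots> \<le> (k + 1) * e * (1 - e)"
    using B e1 unfolding M_def by (intro mult_right_mono) auto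
  also have "\<dots> = e * (k * (1 - e)) + e * (1 - e)" by (simp add: algebra_simps)
  also have "\<dots> \<le> e * ((m + 1) * L) + e * (1 - e)"
    using A e by (intro add_right_mono mult_left_mono) (auto simp: L_def)
  finally have le: "(G - L) * M * (1 - e) \<le> e * ((m + 1) * L) + e * (1 - e)" .
  have key: "(1 - e) * (M * G - e) \<le> L * (M + 3 * e)"
    using le by (simp add: M_def algebra_simps)
  have ln2: "1/2 \<le> ln (2::real)" "ln (2::real) \<le> 1"
    using ln_le_minus_one[of "1/2 :: real"] ln_le_minus_one[of "2 :: real"] by (simp_all add: ln_div)
  have ln32: "ln (32::real) = 5 * ln 2"
    using ln_realpow[of 2 5] by simp
  have "ln (32::real) \<le> G" using m unfolding G_def by simp
  then have G3: "5/2 \<le> G" using ln2 ln32 by simp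
  have ln_tangent: "ln b \<le> ln a + (b / a - 1)" if "0 < a" "0 < b" for a b :: real
    using ln_le_minus_one[of "b / a"] that by (simp add: ln_div)
  \<comment> \<open>For large \<open>p\<close> both sides vanish like \<open>1 - p\<close>; in the middle range \<open>L\<close> is about half of \<open>ln m\<close> at most; for small \<open>p\<close> the error \<open>e \<le> 1 / m\<close> is negligible.\<close>
  consider "1/2 \<le> p" | "p < 1/2" "1 \<le> m * p\<^sup>2" | "m * p\<^sup>2 < 1" by linarith
  then show False
  proof cases
    case 1
    have "L \<le> 1 / p - 1" using ln_le_minus_one[of "1 / p"] p by (simp add: L_def ln_div)
    also have "\<dots> = (1 - p) / p" using p by (simp add: field_simps)
    also have "\<dots> \<le> (1 - p) / (1/2)" using 1 p by (intro divide_left_mono) auto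
    finally have L: "L \<le> 2 * (1 - p)" by simp
    have "(1 - p) * (3/2) \<le> (1 - p) * (1 + p)" using 1 p by (intro mult_left_mono) auto
    also have "\<dots> \<le> 1 - e" using e by (simp add: algebra_simps power2_eq_square)
    finally have E: "(1 - p) * (3/2) \<le> 1 - e" .
    have "M * (5/2) \<le> M * G" using G3 M by (intro mult_left_mono) auto
    then have MG: "M * (5/2) - 1 \<le> M * G - e" using e1 by linarith
    have "((1 - p) * (3/2)) * (M * (5/2) - 1) \<le> (1 - e) * (M * G - e)"
      using MG by (intro mult_mono E) (use p e1 M in auto)
    also have "\<dots> \<le> (2 * (1 - p)) * (M + 3)"
      using key L L0 M e1 p e by (intro order_trans[OF key] mult_mono) auto
    finally have "(1 - p) * ((3/2) * (M * (5/2) - 1)) \<le> (1 - p) * (2 * (M + 3))"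
      by (simp only: mult.assoc mult.left_commute)
    then have "(3/2) * (M * (5/2) - 1) \<le> 2 * (M + 3)" using p by (simp only: mult_le_cancel_left_pos)
    then show False using M by simp
  next
    case 2
    have "p\<^sup>2 \<le> (1/2)\<^sup>2" using 2 p by (intro power_mono) auto
    then have e4: "e \<le> 1/4" using e by (simp add: power2_eq_square)
    have "0 \<le> ln (m * p\<^sup>2)" using 2 by simp
    also have "ln (m * p\<^sup>2) = ln m - 2 * L" using m p by (simp add: ln_mult ln_realpow L_def)
    also have "ln m \<le> G + (m / (m - 1) - 1)" unfolding G_def using m by (intro ln_tangent) auto
    also have "m / (m - 1) - 1 \<le> 1/34" using m by (simp add: field_simps)
    finally have L: "L \<le> G / 2 + 1/68" by simp
    have "3/4 * (M * G - 1/4) \<le> (1 - e) * (M * G - e)"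
      using e4 e M G3 mult_mono[of 33 M "5/2" G] by (intro mult_mono) auto
    also have "\<dots> \<le> (G / 2 + 1/68) * (M + 3/4)"
      using L L0 M e e4 by (intro order_trans[OF key] mult_mono) auto
    finally have "M * G * (1/4) \<le> 3/8 * G + M / 68 + 3/272 + 3/16" by (simp add: field_simps)
    moreover have "33 * G \<le> M * G" using M G3 by (intro mult_right_mono) auto
    moreover have "M * (5/2) \<le> M * G" using M G3 by (intro mult_left_mono) auto
    ultimately show False using M G3 by linarith
  next
    case 3
    have em: "e * m \<le> 1" using e 3 m by (smt (verit) mult.commute mult_left_mono)
    then have e35: "e \<le> 1/35" using m e mult_left_mono[of 35 m e] by simp
    have "G \<le> ln 32 + ((m - 1) / 32 - 1)" unfolding G_def using m by (intro ln_tangent) auto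
    then have Gm: "G \<le> 146/1000 * m" using ln32 ln2 m by (simp add: field_simps)
    have "2 / (m + 2) \<le> p" using p2 m by (simp add: field_simps)
    then have "ln (2 / (m + 2)) \<le> ln p" using m p by (subst ln_le_cancel_iff) auto
    then have "L \<le> ln (m + 2) - ln 2" using m by (simp add: L_def ln_div)
    also have "ln (m + 2) \<le> G + ((m + 2) / (m - 1) - 1)" unfolding G_def using m by (intro ln_tangent) auto
    also have "(m + 2) / (m - 1) - 1 \<le> 3/34" using m by (simp add: field_simps)
    finally have L: "L \<le> G - 41/100" using ln2 by simp
    have eG: "e * G \<le> 146/1000"
    proof -
      have "e * G \<le> e * (146/1000 * m)" using Gm e by (intro mult_left_mono) auto
      then show ?thesis using em by simp
    qed
    have "L * (M + 3 * e) \<le> (G - 41/100) * (M + 3 * e)"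
      using L M e by (intro mult_right_mono) auto
    with key have "(1 - e) * (M * G - e) \<le> (G - 41/100) * (M + 3 * e)" by linarith
    then have "41/100 * M \<le> M * (e * G) + 3 * (e * G) + e - e * e - 123/100 * e"
      by (simp add: field_simps)
    moreover have "M * (e * G) \<le> M * (146/1000)" using eG M by (intro mult_left_mono) auto
    moreover have "0 \<le> e * e" by simp
    ultimately have "41/100 * M \<le> M * (146/1000) + 438/1000 + 1" using eG e e1 by linarith
    then show False using M by simp
  qed
qed

section \<open>Kites\<close>

text \<open>
  The path length \<open>a\<close> is the parameter because it is the distance from the pendant end to the
  clique; \<open>a\<close> is also the vertex at which path and clique meet.
\<close>

definition kite :: "nat \<Rightarrow> nat \<Rightarrow> nat pair_pre_digraph" where
  "kite n a = kite_graph (a + 1) (n - a)"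

lemma pverts_kite: "a < n \<Longrightarrow> pverts (kite n a) = {0..<n}"
  by (simp add: kite_def pverts_kite_graph)

lemma parcs_kite_iff:
  assumes "a < n"
  shows "(i, j) \<in> parcs (kite n a) \<longleftrightarrow>
    i \<le> a \<and> j \<le> a \<and> (j = Suc i \<or> i = Suc j) \<or> a \<le> i \<and> i < n \<and> a \<le> j \<and> j < n \<and> i \<noteq> j"
  using assms by (auto simp: kite_def kite_graph_def path_graph_def complete_graph_on_def)

lemma kite_neighbours:
  assumes "a < n"
  shows "0 < a \<Longrightarrow> parcs (kite n a) `` {0} = {1}"
    and "k + 2 \<le> a \<Longrightarrow> parcs (kite n a) `` {k + 1} = {k, k + 2}"
    and "0 < a \<Longrightarrow> parcs (kite n a) `` {a} = insert (a - 1) {Suc a..<n}"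
    and "a < i \<Longrightarrow> i < n \<Longrightarrow> parcs (kite n a) `` {i} = {a..<n} - {i}"
  using assms by (auto simp: parcs_kite_iff)

text \<open>
  Along the path the eigenvalue equation is exactly the Chebyshev recurrence, and the entry at the
  junction is a lower bound for the largest entry.
\<close>

lemma kite_perron:
  assumes a: "a < n"
  obtains x where "perron {0..<n} (parcs (kite n a)) x (lambda1 (kite n a))"
    and "cheb a (lambda1 (kite n a)) \<le> principal_ratio (kite n a)"
proof -
  let ?K = "kite n a" and ?t = "lambda1 (kite n a)"
  have "pair_graph ?K" "Digraph_Component.connected (with_proj ?K)"
    using a pair_graph_kite_graph connected_kite_graph[of "a + 1" "n - a"] by (simp_all add: kite_def)
  then obtain x where x: "perron {0..<n} (parcs ?K) x ?t"
    and ratio: "principal_ratio ?K = Max (x ` {0..<n}) / Min (x ` {0..<n})"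
    using principal_ratio_perron pverts_kite[OF a] by metis
  interpret perron "{0..<n}" "parcs ?K" x ?t by (rule x)
  have xa: "x a = cheb a ?t * x 0"
  proof (rule recurrence_eq_cheb)
    show "x 1 = ?t * x 0" if "1 \<le> a"
      using that eig[of 0] a kite_neighbours(1)[OF a] by simp
    show "x (k + 2) = ?t * x (k + 1) - x k" if "k + 2 \<le> a" for k
      using that eig[of "k + 1"] a kite_neighbours(2)[OF a that] by simp
  qed simp
  have ne: "{0..<n} \<noteq> {}" using a by auto
  have "Min (x ` {0..<n}) \<in> x ` {0..<n}" using ne by (intro Min_in) auto
  then have min0: "0 < Min (x ` {0..<n})" using pos by auto
  have "Min (x ` {0..<n}) \<le> x 0" using a by (intro Min_le) auto
  moreover have "x a \<le> Max (x ` {0..<n})" using a by (intro Max_ge) auto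
  moreover have "0 < x a" using pos a by simp
  ultimately have "x a / x 0 \<le> Max (x ` {0..<n}) / Min (x ` {0..<n})"
    using min0 by (intro frac_le) auto
  moreover have "x a / x 0 = cheb a ?t" using xa pos[of 0] a by simp
  ultimately show ?thesis using that x ratio by simp
qed

lemma cheb_le_ratio_kite:
  "a < n \<Longrightarrow> cheb a (lambda1 (kite n a)) \<le> principal_ratio (kite n a)"
  using kite_perron by metis

lemma lambda1_kite_ge_subinvariant:
  fixes z :: "nat \<Rightarrow> real"
  assumes a: "a < n"
    and "\<And>i. i < n \<Longrightarrow> 0 \<le> z i" "0 < z a"
    and "\<And>i. i < n \<Longrightarrow> mu * z i \<le> (\<Sum>j\<in>parcs (kite n a) `` {i}. z j)"
  shows "mu \<le> lambda1 (kite n a)"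
proof -
  obtain x where "perron {0..<n} (parcs (kite n a)) x (lambda1 (kite n a))"
    using kite_perron[OF a] by metis
  then interpret perron "{0..<n}" "parcs (kite n a)" x "lambda1 (kite n a)" .
  show ?thesis
  proof (rule subinvariant_le)
    show "\<exists>i\<in>{0..<n}. 0 < z i" using a assms(3) by (intro bexI[of _ a]) auto
  qed (use assms in auto)
qed

text \<open>
  The indicator of the clique is the test vector.
\<close>

lemma lambda1_kite_ge:
  assumes a: "a < n"
  shows "real (n - a) - 1 \<le> lambda1 (kite n a)"
proof (rule lambda1_kite_ge_subinvariant[OF a])
  let ?z = "\<lambda>i. if a \<le> i then 1 else 0 :: real"
  have fin: "finite (parcs (kite n a) `` {i})" for i
    by (rule finite_subset[of _ "{0..<n}"]) (use a in \<open>auto simp: parcs_kite_iff\<close>)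
  show "(real (n - a) - 1) * ?z i \<le> (\<Sum>j\<in>parcs (kite n a) `` {i}. ?z j)" if "i < n" for i
  proof (cases "a \<le> i")
    case True
    then have "real (n - a) - 1 = (\<Sum>j\<in>{a..<n} - {i}. ?z j)"
      using that by (simp add: of_nat_diff)
    also have "\<dots> \<le> (\<Sum>j\<in>parcs (kite n a) `` {i}. ?z j)"
      using True that a fin by (intro sum_mono2) (auto simp: parcs_kite_iff)
    finally show ?thesis using True by simp
  qed (auto intro: sum_nonneg)
qed auto

text \<open>
  A kite whose path takes up half of the vertices is far from optimal, but beats every graph with a
  very long or a very short geodesic.
\<close>

lemma ratio_balanced_kite_ge:
  assumes n: "8 \<le> n"
  shows "real (n - n div 2 - 2) ^ (n div 2) \<le> principal_ratio (kite n (n div 2))"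
proof -
  let ?a = "n div 2" and ?t = "lambda1 (kite n (n div 2))"
  have a: "?a < n" using n by simp
  have t: "real (n - ?a) - 1 \<le> ?t" by (rule lambda1_kite_ge[OF a])
  have "real (n - ?a - 2) ^ ?a \<le> (?t - 1) ^ ?a"
    using t n by (intro power_mono) auto
  also have "\<dots> \<le> cheb ?a ?t" using t n by (intro power_le_cheb) auto
  also have "\<dots> \<le> principal_ratio (kite n ?a)" by (rule cheb_le_ratio_kite[OF a])
  finally show ?thesis .
qed

section \<open>Geodesics between extreme entries\<close>

text \<open>
  A Perron vector with largest entry \<open>1\<close>, attained at the end of a geodesic. The estimates
  have the form \<open>1 \<le> c * x (v 0)\<close>, which bounds the ratio of the two end entries by \<open>c\<close>.
\<close>

locale normalised_geodesic = perron V E x lam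
  for V :: "'a set" and E x lam +
  fixes v :: "nat \<Rightarrow> 'a" and d :: nat
  assumes v0: "v 0 \<in> V"
    and walk: "i < d \<Longrightarrow> (v i, v (Suc i)) \<in> E"
    and shortest: "(v 0, v d) \<in> E ^^ k \<Longrightarrow> d \<le> k"
    and x_end: "x (v d) = 1" and x_le_1: "y \<in> V \<Longrightarrow> x y \<le> 1"
begin

definition outside :: "'a set" where
  "outside = V - v ` {..d}"

abbreviation m :: nat where
  "m \<equiv> card outside"

lemma v_in: "i \<le> d \<Longrightarrow> v i \<in> V"
proof (cases i)
  case (Suc j)
  then show "i \<le> d \<Longrightarrow> v i \<in> V" using walk[of j] EV by auto
qed (use v0 in simp)

lemma walk_relpow: "i + l \<le> d \<Longrightarrow> (v i, v (i + l)) \<in> E ^^ l"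
proof (induction l)
  case (Suc l)
  then have "(v i, v (i + l)) \<in> E ^^ l" "(v (i + l), v (Suc (i + l))) \<in> E" using walk by auto
  then show ?case by auto
qed simp

lemma geodesic_dist:
  assumes "i + l \<le> d" "(v i, v (i + l)) \<in> E ^^ k"
  shows "l \<le> k"
proof -
  have "(v 0, v i) \<in> E ^^ i" using walk_relpow[of 0 i] assms(1) by simp
  moreover have "(v (i + l), v d) \<in> E ^^ (d - (i + l))"
    using walk_relpow[of "i + l" "d - (i + l)"] assms(1) by simp
  ultimately have "(v 0, v d) \<in> E ^^ (i + k + (d - (i + l)))"
    using assms(2) unfolding relpow_add by blast
  from shortest[OF this] show ?thesis using assms(1) by simp
qed

lemma geodesic_dist':
  assumes "i \<le> d" "j \<le> d" "(v i, v j) \<in> E ^^ k"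
  shows "j \<le> i + k"
proof (cases "i \<le> j")
  case True
  then show ?thesis using geodesic_dist[of i "j - i" k] assms by simp
qed simp

lemma v_inj: "inj_on v {..d}"
proof (rule inj_onI)
  fix i j assume "i \<in> {..d}" "j \<in> {..d}" "v i = v j"
  then show "i = j" using geodesic_dist'[of i j 0] geodesic_dist'[of j i 0] by simp
qed

lemma v_adjacent_iff:
  assumes "i \<le> d" "j \<le> d"
  shows "(v i, v j) \<in> E \<longleftrightarrow> j = Suc i \<or> i = Suc j"
proof
  assume E: "(v i, v j) \<in> E"
  then have "(v j, v i) \<in> E" using symE by (auto dest: symD)
  then have "j \<le> i + 1" "i \<le> j + 1" 
    using assms E geodesic_dist'[of i j 1] geodesic_dist'[of j i 1] by simp_all
  moreover have "i \<noteq> j" using E irreflE by (auto simp: irrefl_def)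
  ultimately show "j = Suc i \<or> i = Suc j" by linarith
next
  assume "j = Suc i \<or> i = Suc j"
  then show "(v i, v j) \<in> E" using assms walk[of i] symD[OF symE walk[of j]] by auto
qed

lemma common_neighbour:
  assumes "i \<le> d" "j \<le> d" "(v i, y) \<in> E" "(y, v j) \<in> E"
  shows "j \<le> i + 2"
proof -
  have "(v i, v j) \<in> E ^^ 2" using assms(3,4) by (auto simp: numeral_2_eq_2)
  then show ?thesis using geodesic_dist' assms(1,2) by blast
qed

lemma finite_outside: "finite outside"
  using finV by (simp add: outside_def)

lemma card_V: "card V = m + d + 1"
proof -
  have "v ` {..d} \<subseteq> V" using v_in by auto
  moreover have "card (v ` {..d}) = d + 1" using v_inj by (simp add: card_image)
  ultimately have "m = card V - (d + 1)" "d + 1 \<le> card V"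
    using card_mono[OF finV, of "v ` {..d}"] by (simp_all add: outside_def card_Diff_subset)
  then show ?thesis by simp
qed

lemma v_notin_outside: "i \<le> d \<Longrightarrow> v i \<notin> outside"
  by (auto simp: outside_def)

lemma neighbours_end:
  assumes "1 \<le> d"
  shows "E `` {v d} \<subseteq> insert (v (d - 1)) outside"
proof
  fix y assume y: "y \<in> E `` {v d}"
  show "y \<in> insert (v (d - 1)) outside"
  proof (cases "y \<in> v ` {..d}")
    case True
    then obtain j where "j \<le> d" "y = v j" by auto
    then show ?thesis using y v_adjacent_iff[of d j] by auto
  next
    case False
    then show ?thesis using y EV by (auto simp: outside_def)
  qed
qed

lemma lam_le_degree: "lam \<le> card (E `` {v d})"
proof -
  have "lam = (\<Sum>j\<in>E `` {v d}. x j)" using eig[of "v d"] x_end v_in by simp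
  also have "\<dots> \<le> (\<Sum>j\<in>E `` {v d}. 1)" using x_le_1 EV by (intro sum_mono) auto
  finally show ?thesis by simp
qed

text \<open>
  At a largest entry the eigenvalue is at most the degree, and the only neighbour of \<open>v d\<close> on the
  geodesic is \<open>v (d - 1)\<close>.
\<close>

lemma lam_le: assumes "1 \<le> d" shows "lam \<le> m + 1"
proof -
  have "card (E `` {v d}) \<le> card (insert (v (d - 1)) outside)"
    using neighbours_end[OF assms] finite_outside by (intro card_mono) auto
  also have "\<dots> \<le> m + 1" using card_insert_le_m1[of "m + 1" outside] by (simp add: card_insert_if finite_outside)
  finally show ?thesis using lam_le_degree by linarith
qed

lemma neighbour_le:
  assumes "(i, j) \<in> E" shows "x j \<le> lam * x i"
proof -
  have "x j \<le> (\<Sum>j\<in>E `` {i}. x j)"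
    using assms finite_nbhd pos EV by (intro member_le_sum) (auto simp: less_imp_le)
  then show ?thesis using eig assms EV by auto
qed

lemma end_le_power:
  assumes "1 \<le> d" "lam \<le> b"
  shows "1 \<le> b ^ d * x (v 0)"
proof -
  have b0: "0 \<le> b"
  proof -
    have "0 < x (v 1)" "0 < x (v 0)" using pos v_in assms by auto
    moreover have "x (v 1) \<le> lam * x (v 0)" using neighbour_le walk[of 0] assms by simp
    ultimately have "0 < lam" by (smt (verit) mult_nonneg_nonneg zero_less_mult_iff)
    then show ?thesis using assms by simp
  qed
  have "x (v i) \<le> b ^ i * x (v 0)" if "i \<le> d" for i
    using that
  proof (induction i)
    case (Suc i)
    have "x (v (Suc i)) \<le> lam * x (v i)" using neighbour_le walk Suc.prems by simp
    also have "\<dots> \<le> b * x (v i)" using assms pos v_in Suc.prems by (intro mult_right_mono) (auto simp: less_imp_le)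
    also have "\<dots> \<le> b * (b ^ i * x (v 0))" using Suc b0 by (intro mult_left_mono) auto
    finally show ?case by simp
  qed simp
  from this[of d] show ?thesis by (simp add: x_end)
qed

lemma end_le_cheb:
  assumes t: "2 \<le> t" "lam \<le> t"
  shows "1 \<le> cheb d t * x (v 0)"
proof -
  have "x (v d) \<le> cheb d t * x (v 0)"
  proof (rule recurrence_le_cheb[OF t(1)])
    show "x (v 1) \<le> t * x (v 0)" if "1 \<le> d"
    proof -
      have "x (v 1) \<le> lam * x (v 0)" using neighbour_le walk[of 0] that by simp
      also have "\<dots> \<le> t * x (v 0)" using t pos v_in by (intro mult_right_mono) (auto simp: less_imp_le)
      finally show ?thesis .
    qed
    show "x (v (k + 2)) \<le> t * x (v (k + 1)) - x (v k)" if k: "k + 2 \<le> d" for k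
    proof -
      have ne: "v k \<noteq> v (k + 2)" using inj_onD[OF v_inj, of k "k + 2"] k by auto
      have "x (v k) + x (v (k + 2)) = (\<Sum>j\<in>{v k, v (k + 2)}. x j)" using ne by simp
      also have "\<dots> \<le> (\<Sum>j\<in>E `` {v (k + 1)}. x j)"
        using k finite_nbhd pos EV by (intro sum_mono2) (auto simp: v_adjacent_iff less_imp_le)
      also have "\<dots> = lam * x (v (k + 1))" using eig v_in k by simp
      also have "\<dots> \<le> t * x (v (k + 1))"
        using t pos v_in k by (intro mult_right_mono) (auto simp: less_imp_le)
      finally show ?thesis by simp
    qed
  qed simp
  then show ?thesis by (simp add: x_end)
qed

text \<open>
  The kite of path length \<open>d\<close> has eigenvalue at least \<open>m\<close>. An eigenvalue above that makes the
  graph rigid: \<open>v d\<close> needs more than \<open>m\<close> neighbours, so it sees every outside vertex, and then no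
  outside vertex can see the geodesic before its last three vertices.
\<close>

context
  assumes d3: "3 \<le> d" and lam_gt: "m < lam"
begin

lemma end_neighbours: "E `` {v d} = insert (v (d - 1)) outside"
proof (rule card_subset_eq)
  have "v (d - 1) \<notin> outside" by (simp add: v_notin_outside)
  then have c: "card (insert (v (d - 1)) outside) = m + 1" by (simp add: finite_outside)
  have "card (E `` {v d}) \<le> card (insert (v (d - 1)) outside)"
    using neighbours_end d3 finite_outside by (intro card_mono) auto
  moreover have "m < card (E `` {v d})" using lam_le_degree lam_gt by linarith
  ultimately show "card (E `` {v d}) = card (insert (v (d - 1)) outside)" using c by simp
qed (use neighbours_end d3 finite_outside in auto)

lemma outside_adjacent_end: "y \<in> outside \<Longrightarrow> (v d, y) \<in> E"
  using end_neighbours by auto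

lemma outside_not_adjacent:
  assumes "y \<in> outside" "k + 3 \<le> d" shows "(v k, y) \<notin> E"
proof
  assume "(v k, y) \<in> E"
  moreover have "(y, v d) \<in> E" using outside_adjacent_end[OF assms(1)] symE by (auto dest: symD)
  ultimately have "d \<le> k + 2" using assms(2) by (intro common_neighbour) auto
  then show False using assms(2) by simp
qed

lemma neighbours_v:
  assumes "k \<le> d"
  shows "E `` {v k} = {v j |j. j \<le> d \<and> (j = Suc k \<or> k = Suc j)} \<union> (outside \<inter> E `` {v k})"
proof -
  have "E `` {v k} = (v ` {..d} \<inter> E `` {v k}) \<union> (outside \<inter> E `` {v k})"
    using EV by (auto simp: outside_def)
  also have "v ` {..d} \<inter> E `` {v k} = {v j |j. j \<le> d \<and> (j = Suc k \<or> k = Suc j)}"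
    using assms by (auto simp: v_adjacent_iff)
  finally show ?thesis .
qed

lemma eig_v_Suc:
  assumes "k + 2 \<le> d"
  shows "lam * x (v (k + 1)) = x (v k) + x (v (k + 2)) + sum x (outside \<inter> E `` {v (k + 1)})"
proof -
  have "{v j |j. j \<le> d \<and> (j = Suc (k + 1) \<or> k + 1 = Suc j)} = {v k, v (k + 2)}"
    using assms by (auto intro: exI[of _ k] exI[of _ "Suc (Suc k)"])
  then have N: "E `` {v (k + 1)} = {v k, v (k + 2)} \<union> (outside \<inter> E `` {v (k + 1)})"
    using neighbours_v[of "k + 1"] assms by simp
  have "v k \<noteq> v (k + 2)" using inj_onD[OF v_inj, of k "k + 2"] assms by auto
  moreover have "lam * x (v (k + 1)) = sum x ({v k, v (k + 2)} \<union> (outside \<inter> E `` {v (k + 1)}))"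
    using eig[of "v (k + 1)"] v_in assms by (subst N[symmetric]) auto
  moreover have "{v k, v (k + 2)} \<inter> (outside \<inter> E `` {v (k + 1)}) = {}"
    using v_notin_outside assms by auto
  ultimately show ?thesis using finite_outside by (simp add: sum.union_disjoint)
qed

lemma x_eq_cheb:
  assumes "k \<le> d - 2"
  shows "x (v k) = cheb k lam * x (v 0)"
proof (rule recurrence_eq_cheb[of "d - 2"])
  have "outside \<inter> E `` {v 0} = {}" using outside_not_adjacent[of _ 0] d3 by auto
  then have "E `` {v 0} = {v 1}" using neighbours_v[of 0] d3 by auto
  then show "x (v 1) = lam * x (v 0)" using eig[of "v 0"] v0 by simp
  show "x (v (k + 2)) = lam * x (v (k + 1)) - x (v k)" if "k + 2 \<le> d - 2" for k
  proof -
    have "outside \<inter> E `` {v (k + 1)} = {}" using outside_not_adjacent[of _ "k + 1"] that by auto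
    then show ?thesis using eig_v_Suc[of k] that by simp
  qed
qed fact

lemma cheb_pred:
  "cheb (d - 1) lam * x (v 0) = x (v (d - 1)) + sum x (outside \<inter> E `` {v (d - 2)})"
proof -
  obtain k where k: "d = k + 3" using that[of "d - 3"] d3 by simp
  then have d: "d - 1 = Suc (Suc k)" "d - 2 = Suc k" by simp_all
  have "cheb (d - 1) lam * x (v 0) = lam * (cheb (k + 1) lam * x (v 0)) - cheb k lam * x (v 0)"
    unfolding d by (simp add: left_diff_distrib)
  also have "\<dots> = lam * x (v (k + 1)) - x (v k)" using x_eq_cheb[of k] x_eq_cheb[of "k + 1"] k by simp
  finally show ?thesis using eig_v_Suc[of k] d k by simp
qed

lemma lam_eq: "lam = x (v (d - 1)) + sum x outside"
proof -
  have "lam * x (v d) = sum x (insert (v (d - 1)) outside)"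
    using eig[of "v d"] v_in end_neighbours by simp
  then show ?thesis using finite_outside v_notin_outside by (simp add: x_end)
qed

text \<open>
  If an outside vertex \<open>y\<close> sees \<open>v (d - 2)\<close>, then \<open>y\<close> and \<open>v (d - 1)\<close> share the Chebyshev value of
  level \<open>d - 1\<close>. The neighbours of \<open>v d\<close> lose less than \<open>1\<close> in total against the maximum, so the
  two entries together still reach \<open>1\<close>.
\<close>

lemma early_branch:
  assumes "outside \<inter> E `` {v (d - 2)} \<noteq> {}"
  shows "1 \<le> cheb (d - 1) lam * x (v 0)"
proof -
  obtain y where y: "y \<in> outside" "y \<in> E `` {v (d - 2)}" using assms by auto
  have xV: "i \<in> outside \<Longrightarrow> 0 < x i \<and> x i \<le> 1" for i using pos x_le_1 by (auto simp: outside_def)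
  have "x y \<le> sum x (outside \<inter> E `` {v (d - 2)})"
    using y finite_outside xV by (intro member_le_sum) (auto simp: less_imp_le)
  moreover have "sum x outside = x y + sum x (outside - {y})"
    using y finite_outside by (simp add: sum.remove)
  moreover have "sum x (outside - {y}) \<le> (\<Sum>i\<in>outside - {y}. 1)"
    using xV by (intro sum_mono) auto
  moreover have "(\<Sum>i\<in>outside - {y}. 1 :: real) = real m - 1"
  proof -
    have "1 \<le> m" using y finite_outside by (auto simp: Suc_le_eq card_gt_0_iff)
    then show ?thesis using y finite_outside by (simp add: of_nat_diff)
  qed
  ultimately show ?thesis using cheb_pred lam_eq lam_gt by linarith
qed

context
  assumes nb: "outside \<inter> E `` {v (d - 2)} = {}"
begin

text \<open>
  If this set is empty, the graph is a subgraph of a kite; the larger it is, the closer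
  \<open>v (d - 1)\<close> comes to being one more vertex of the clique.
\<close>

definition branch :: "'a set" where "branch = outside \<inter> E `` {v (d - 1)}"

lemma x_pred_eq: "x (v (d - 1)) = cheb (d - 1) lam * x (v 0)"
  using cheb_pred nb by simp

lemma eig_pred: "lam * x (v (d - 1)) = x (v (d - 2)) + 1 + sum x branch"
  using eig_v_Suc[of "d - 2"] d3 x_end by (simp add: branch_def Suc_diff_Suc numeral_2_eq_2)

lemma cheb_end: "cheb d lam * x (v 0) = 1 + sum x branch"
proof -
  obtain k where k: "d = k + 3" using that[of "d - 3"] d3 by simp
  then have d: "d = Suc (Suc (Suc k))" "d - 1 = Suc (Suc k)" "d - 2 = Suc k" by simp_all
  have "cheb d lam * x (v 0) = lam * (cheb (d - 1) lam * x (v 0)) - cheb (d - 2) lam * x (v 0)"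
    unfolding d(2,3) by (subst d(1)) (simp add: left_diff_distrib)
  then show ?thesis using eig_pred x_pred_eq x_eq_cheb[of "d - 2"] by simp
qed

lemma eig_outside_le:
  assumes y: "y \<in> outside" "y \<notin> branch"
  shows "lam * x y \<le> 1 + sum x outside - x y"
proof -
  have "E `` {y} \<subseteq> insert (v d) (outside - {y})"
  proof
    fix z assume z: "z \<in> E `` {y}"
    then have z': "z \<in> V" "(z, y) \<in> E" "z \<noteq> y"
      using EV symE irreflE by (auto dest: symD simp: irrefl_def)
    show "z \<in> insert (v d) (outside - {y})"
    proof (cases "z \<in> v ` {..d}")
      case True
      then obtain j where j: "j \<le> d" "z = v j" by auto
      have "\<not> j + 3 \<le> d" "j \<noteq> d - 2" "j \<noteq> d - 1"
        using outside_not_adjacent[OF y(1), of j] nb y z' j by (auto simp: branch_def)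
      then have "j = d" using j(1) by linarith
      then show ?thesis using j by simp
    qed (use z' in \<open>auto simp: outside_def\<close>)
  qed
  moreover have "0 \<le> x i" if "i \<in> insert (v d) (outside - {y})" for i
    using that pos[of i] v_in[of d] by (auto simp: outside_def less_imp_le)
  ultimately have "sum x (E `` {y}) \<le> sum x (insert (v d) (outside - {y}))"
    using finite_outside by (intro sum_mono2) auto
  also have "\<dots> = 1 + (sum x outside - x y)"
    using finite_outside y v_notin_outside by (simp add: x_end sum_diff1)
  finally show ?thesis using eig[of y] y by (simp add: outside_def)
qed

text \<open>
  If the geodesic is a pendant path up to \<open>v d\<close>, the graph is a subgraph of a kite. The test vector
  copies \<open>x\<close> on the path and is constant, equal to the mean of \<open>x\<close> over the outside, on the rest of
  the clique.
\<close>

lemma lam_le_kite: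
  assumes "branch = {}" "1 \<le> m"
  shows "lam \<le> lambda1 (kite (card V) d)"
proof -
  let ?n = "card V" and ?s = "sum x outside / m"
  define z where "z = (\<lambda>i. if i \<le> d then x (v i) else ?s)"
  have dn: "d < ?n" using card_V by simp
  have s0: "0 \<le> ?s" using pos by (intro divide_nonneg_nonneg sum_nonneg) (auto simp: outside_def less_imp_le)
  have sm: "m * ?s = sum x outside" using assms by simp
  show ?thesis
  proof (rule lambda1_kite_ge_subinvariant[OF dn])
    show "0 < z d" by (simp add: z_def x_end)
    show "0 \<le> z i" for i using s0 pos v_in by (auto simp: z_def less_imp_le)
    fix i assume i: "i < ?n"
    have "i = 0 \<or> (i = (i - 1) + 1 \<and> (i - 1) + 2 \<le> d) \<or> i = d \<or> d < i" by linarith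
    then consider "i = 0" | k where "i = k + 1" "k + 2 \<le> d" | "i = d" | "d < i"
      by blast
    then show "lam * z i \<le> (\<Sum>j\<in>parcs (kite ?n d) `` {i}. z j)"
    proof cases
      case 1
      then show ?thesis using kite_neighbours(1)[OF dn] d3 x_eq_cheb[of 1] by (simp add: z_def)
    next
      case (2 k)
      have "outside \<inter> E `` {v (k + 1)} = {}"
      proof -
        consider "k + 4 \<le> d" | "k + 1 = d - 2" | "k + 1 = d - 1" using 2 d3 by linarith
        then show ?thesis
        proof cases
          case 1
          then show ?thesis using outside_not_adjacent[of _ "k + 1"] by auto
        qed (use nb assms in \<open>simp_all only: branch_def\<close>)
      qed
      then have "lam * x (v (k + 1)) = x (v k) + x (v (k + 2))" using eig_v_Suc 2 by simp
      then show ?thesis using 2 kite_neighbours(2)[OF dn 2(2)] by (simp add: z_def)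
    next
      case 3
      have "(\<Sum>j\<in>parcs (kite ?n d) `` {d}. z j) = z (d - 1) + (\<Sum>j\<in>{Suc d..<?n}. z j)"
        using kite_neighbours(3)[OF dn] d3 by simp
      also have "(\<Sum>j\<in>{Suc d..<?n}. z j) = (\<Sum>j\<in>{Suc d..<?n}. ?s)"
        by (intro sum.cong) (auto simp: z_def)
      also have "\<dots> = m * ?s" by (simp add: card_V)
      finally show ?thesis using 3 lam_eq sm by (simp add: z_def x_end)
    next
      case 4
      have "lam * sum x outside = (\<Sum>y\<in>outside. lam * x y)" by (simp add: sum_distrib_left)
      also have "\<dots> \<le> (\<Sum>y\<in>outside. 1 + sum x outside - x y)"
        using eig_outside_le assms by (intro sum_mono) auto
      also have "\<dots> = m + (real m - 1) * sum x outside"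
        by (simp add: sum.distrib sum_subtractf algebra_simps)
      finally have "lam * sum x outside \<le> m + (real m - 1) * sum x outside" .
      then have "lam * ?s \<le> (m + (real m - 1) * sum x outside) / m"
        using assms(2) by (simp add: divide_right_mono)
      also have "\<dots> = 1 + (real m - 1) * ?s" using assms(2) by (simp add: add_divide_distrib)
      also have "\<dots> = z d + (\<Sum>j\<in>{Suc d..<?n} - {i}. ?s)"
        using 4 i assms(2) by (simp add: z_def x_end card_V of_nat_diff)
      also have "\<dots> = z d + (\<Sum>j\<in>{Suc d..<?n} - {i}. z j)"
        by (intro arg_cong2[where f = "(+)"] sum.cong refl) (auto simp: z_def)
      also have "\<dots> = (\<Sum>j\<in>insert d ({Suc d..<?n} - {i}). z j)" by simp
      also have "insert d ({Suc d..<?n} - {i}) = parcs (kite ?n d) `` {i}"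
        unfolding kite_neighbours(4)[OF dn 4 i] using 4(1) dn by auto
      finally show ?thesis using 4 by (simp add: z_def)
    qed
  qed
qed

text \<open>
  The excess \<open>e\<close> of \<open>lam\<close> over \<open>m\<close> is paid for by \<open>v (d - 1)\<close> acting as one more vertex of the
  clique. An outside vertex that misses \<open>v (d - 1)\<close> has entry at most \<open>1 - p / (lam + 1)\<close>; summing
  over the neighbours of \<open>v d\<close> gives \<open>e (lam + 1) \<le> p (card branch + 1 + e)\<close>. Conversely the
  branch vertices have entries so close to \<open>1\<close> that the equation at \<open>v (d - 1)\<close> forces
  \<open>card branch + 1 + e \<le> (lam + 1) p\<close>. Hence \<open>e \<le> p\<^sup>2\<close>.
\<close>

lemma excess_bounds:
  fixes p q e :: real
  assumes "branch \<noteq> {}"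
  defines "p \<equiv> x (v (d - 1))" and "q \<equiv> x (v (d - 2))" and "e \<equiv> lam - real m"
  shows "card branch + 1 + e \<le> (lam + 1) * p - q" and "e \<le> p\<^sup>2"
proof -
  have finT: "finite branch" "branch \<subseteq> outside" using finite_outside by (auto simp: branch_def)
  have p0: "0 < p" and q0: "0 < q" using pos v_in by (auto simp: p_def q_def)
  have lam0: "0 < lam" using lam_gt by linarith
  have xV: "i \<in> outside \<Longrightarrow> 0 < x i \<and> x i \<le> 1" for i using pos x_le_1 by (auto simp: outside_def)
  have split: "sum x outside = sum x branch + sum x (outside - branch)"
    using finT finite_outside by (metis add.commute sum.subset_diff)
  have cR: "real (card (outside - branch)) = real m - card branch"
    using finT finite_outside by (simp add: card_Diff_subset card_mono of_nat_diff)
  have ST: "sum x branch \<le> card branch"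
    using sum_mono[of branch x "\<lambda>_. 1"] xV finT by auto
  have R1: "x y \<le> 1 - p / (lam + 1)" if "y \<in> outside - branch" for y
  proof -
    have "lam * x y \<le> 1 + sum x outside - x y" using eig_outside_le that by simp
    also have "sum x outside = lam - p" using lam_eq by (simp add: p_def)
    finally have "(lam + 1) * x y \<le> (lam + 1) - p" by (simp add: algebra_simps)
    then show ?thesis using lam0 by (simp add: field_simps)
  qed
  have SR: "sum x (outside - branch) \<le> (real m - card branch) * (1 - p / (lam + 1))"
    using sum_mono[of "outside - branch" x "\<lambda>_. 1 - p / (lam + 1)"] R1 cR by simp
  have cT: "real (card branch) \<le> m" using finT finite_outside by (simp add: card_mono)
  have "(real m - card branch) * (1 - p / (lam + 1)) \<le> (real m - card branch) * 1"
    using cT p0 lam0 by (intro mult_left_mono) auto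
  then have SR1: "sum x (outside - branch) \<le> real m - card branch" using SR by simp
  have "e - p + card branch \<le> sum x branch"
    using lam_eq split SR1 by (simp add: e_def p_def)
  moreover have "lam * p = q + 1 + sum x branch" using eig_pred by (simp add: p_def q_def)
  ultimately show first: "card branch + 1 + e \<le> (lam + 1) * p - q" by (simp add: algebra_simps)
  have "e \<le> p - (real m - card branch) * (p / (lam + 1))"
    using lam_eq split ST SR by (simp add: e_def p_def algebra_simps)
  then have "e * (lam + 1) \<le> (p - (real m - card branch) * (p / (lam + 1))) * (lam + 1)"
    using lam0 by (intro mult_right_mono) auto
  also have "\<dots> = p * (lam + 1) - (real m - card branch) * p"
    using lam0 by (simp only: left_diff_distrib) simp
  also have "\<dots> = p * (card branch + 1 + e)"
    by (simp add: e_def algebra_simps)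
  also have "\<dots> \<le> p * ((lam + 1) * p)"
    using first p0 q0 by (intro mult_left_mono) auto
  finally have "e * (lam + 1) \<le> p\<^sup>2 * (lam + 1)" by (simp add: power2_eq_square algebra_simps)
  then show "e \<le> p\<^sup>2" using lam0 by simp
qed

text \<open>
  With \<open>p = x (v (d - 1))\<close> and \<open>S = 1 + sum x branch\<close>, the entry \<open>1\<close> of \<open>v d\<close> has two exact
  descriptions, \<open>cheb (d - 1) lam * x (v 0) / p\<close> and \<open>cheb d lam * x (v 0) / S\<close>. Replacing \<open>lam\<close> by
  \<open>m + 1\<close> in the first gains at least a factor \<open>((m + 1) / lam) ^ (d - 1)\<close>, and replacing it by \<open>m\<close> in the
  second loses at most a factor \<open>((lam - 2) / (m - 2)) ^ d\<close>. If the gain stayed below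
  \<open>1 / p\<close> and the loss exceeded \<open>S\<close>, then \<open>d\<close> would have to be both small and large.
\<close>

lemma late_branch:
  assumes br: "branch \<noteq> {}" and m35: "35 \<le> m"
  shows "1 \<le> cheb (d - 1) (m + 1) * x (v 0) \<or> 1 \<le> cheb d m * x (v 0)"
proof (rule ccontr)
  assume "\<not> ?thesis"
  then have A: "cheb (d - 1) (m + 1) * x (v 0) < 1" and B: "cheb d m * x (v 0) < 1" by auto
  let ?k = "d - 1"
  define p q e S where "p = x (v (d - 1))" and "q = x (v (d - 2))" and "e = lam - real m"
    and "S = 1 + sum x branch"
  have x0: "0 < x (v 0)" using pos v0 by simp
  have p0: "0 < p" and q0: "0 < q" using pos v_in by (auto simp: p_def q_def)
  have lam2: "35 < lam" using lam_gt m35 by linarith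
  have lamle: "lam \<le> m + 1" using lam_le d3 by simp
  have e: "0 \<le> e" using lam_gt by (simp add: e_def)
  note bounds = excess_bounds[OF br, folded p_def q_def e_def]
  have "1 \<le> card branch" using br finite_outside by (auto simp: branch_def Suc_le_eq card_gt_0_iff)
  then have "2 \<le> (lam + 1) * p" using bounds(1) e q0 by linarith
  also have "\<dots> \<le> (m + 2) * p" using lamle p0 by (intro mult_right_mono) auto
  finally have p2: "2 \<le> (real m + 2) * p" by (simp add: add.commute)
  have qp: "q \<le> p"
  proof -
    have "cheb (d - 2) lam \<le> cheb (Suc (d - 2)) lam" using lam2 by (intro cheb_le_Suc) auto
    also have "Suc (d - 2) = d - 1" using d3 by simp
    finally show ?thesis using x_eq_cheb[of "d - 2"] x_pred_eq x0 by (simp add: p_def q_def)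
  qed
  have S: "p * (real m - 1) \<le> S"
  proof -
    have "S = lam * p - q" using eig_pred by (simp add: S_def p_def q_def)
    moreover have "real m * p \<le> lam * p" using lam_gt p0 by (intro mult_right_mono) auto
    ultimately show ?thesis using qp by (simp add: algebra_simps)
  qed
  have S0: "0 < S" using S mult_pos_pos[OF p0, of "real m - 1"] m35 by simp
  have pw: "(real m + 1) ^ ?k * p < lam ^ ?k"
  proof -
    have "(real m + 1) ^ ?k * p = ((real m + 1) ^ ?k * cheb ?k lam) * x (v 0)"
      using x_pred_eq by (simp add: p_def)
    also have "\<dots> \<le> (lam ^ ?k * cheb ?k (real m + 1)) * x (v 0)"
      using lam2 lamle x0 by (intro mult_right_mono cheb_power_mono) auto
    also have "\<dots> = lam ^ ?k * (cheb ?k (real m + 1) * x (v 0))" by simp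
    also have "\<dots> < lam ^ ?k * 1" using A lam2 by (intro mult_strict_left_mono) (auto simp: add.commute)
    finally show ?thesis by simp
  qed
  have p1: "p < 1"
  proof (rule ccontr)
    assume "\<not> p < 1"
    then have "(real m + 1) ^ ?k * 1 \<le> (real m + 1) ^ ?k * p" by (intro mult_left_mono) auto
    moreover have "lam ^ ?k \<le> (real m + 1) ^ ?k" using lamle lam2 by (intro power_mono) auto
    ultimately show False using pw by linarith
  qed
  have lnA: "real ?k * (1 - e) < (real m + 1) * - ln p"
  proof -
    have "ln ((real m + 1) ^ ?k * p) < ln (lam ^ ?k)" using pw p0 lam2 by (subst ln_less_cancel_iff) auto
    then have "?k * ln (real m + 1) + ln p < ?k * ln lam"
      using p0 lam2 by (simp add: ln_mult ln_realpow)
    moreover have "ln lam \<le> ln (real m + 1) + (lam / (real m + 1) - 1)"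
      using ln_le_minus_one[of "lam / (real m + 1)"] lam2 by (simp add: ln_div)
    then have "?k * ln lam \<le> ?k * (ln (real m + 1) + (lam / (real m + 1) - 1))"
      by (intro mult_left_mono) auto
    ultimately have "?k * (1 - lam / (real m + 1)) < - ln p" by (simp add: algebra_simps)
    moreover have "1 - lam / (real m + 1) = (1 - e) / (real m + 1)"
      by (simp add: e_def field_simps)
    ultimately have "?k * ((1 - e) / (real m + 1)) < - ln p" by (simp only:)
    then show ?thesis by (simp add: pos_divide_less_eq mult.commute)
  qed
  have lnB: "ln S * (real m - 2) < (real ?k + 1) * e"
  proof -
    have "(real m - 2) ^ d * S = ((real m - 2) ^ d * cheb d lam) * x (v 0)"
      using cheb_end by (simp add: S_def)
    also have "\<dots> \<le> ((lam - 2) ^ d * cheb d m) * x (v 0)"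
      using m35 lam_gt x0 by (intro mult_right_mono cheb_power_antimono) auto
    also have "\<dots> = (lam - 2) ^ d * (cheb d m * x (v 0))" by simp
    also have "\<dots> < (lam - 2) ^ d * 1" using B lam2 by (intro mult_strict_left_mono) auto
    finally have "ln ((real m - 2) ^ d * S) < ln ((lam - 2) ^ d)"
      using S0 m35 lam2 by (subst ln_less_cancel_iff) auto
    then have "d * ln (real m - 2) + ln S < d * ln (lam - 2)"
      using S0 m35 lam2 by (simp add: ln_mult ln_realpow)
    moreover have "ln (lam - 2) \<le> ln (real m - 2) + ((lam - 2) / (real m - 2) - 1)"
      using ln_le_minus_one[of "(lam - 2) / (real m - 2)"] m35 lam2 by (simp add: ln_div)
    then have "d * ln (lam - 2) \<le> d * (ln (real m - 2) + ((lam - 2) / (real m - 2) - 1))"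
      by (intro mult_left_mono) auto
    ultimately have "ln S < d * ((lam - 2) / (real m - 2) - 1)" by (simp add: algebra_simps)
    moreover have "(lam - 2) / (real m - 2) - 1 = e / (real m - 2)"
      using m35 by (simp add: e_def field_simps)
    ultimately have "ln S * (real m - 2) < d * e" using m35 by (simp add: field_simps)
    moreover have "real ?k + 1 = d" using d3 by (simp add: of_nat_diff)
    ultimately show ?thesis by simp
  qed
  show False
    using growth_exponents_incompatible[OF _ p0 p1 e bounds(2) p2 S lnA lnB] m35 by simp
qed

end
end

text \<open>
  The bounds \<open>m\<close> and \<open>m + 1\<close> for the eigenvalues of the kites of path lengths \<open>d\<close> and \<open>d - 1\<close>
  turn every case into a win for one of these two kites.
\<close>

lemma end_le_kite:
  assumes d3: "3 \<le> d" and m35: "35 \<le> m"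
  shows "\<exists>a < card V. 1 \<le> principal_ratio (kite (card V) a) * x (v 0)"
proof -
  let ?n = "card V"
  define t1 t0 where "t1 = lambda1 (kite ?n d)" and "t0 = lambda1 (kite ?n (d - 1))"
  have dn: "d < ?n" "d - 1 < ?n" using card_V by auto
  have t1: "m \<le> t1" using lambda1_kite_ge[OF dn(1)] by (simp add: t1_def card_V)
  have t0: "m + 1 \<le> t0"
    using lambda1_kite_ge[OF dn(2)] d3 by (simp add: t0_def card_V of_nat_diff)
  have x0: "0 < x (v 0)" using pos v0 by simp
  have kite: ?thesis if "a < ?n" "1 \<le> cheb a t * x (v 0)" "2 \<le> t" "t \<le> lambda1 (kite ?n a)" for a t
  proof -
    have "cheb a t \<le> principal_ratio (kite ?n a)"
      using cheb_mono[OF that(3,4), of a] cheb_le_ratio_kite[OF that(1)] by linarith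
    then have "cheb a t * x (v 0) \<le> principal_ratio (kite ?n a) * x (v 0)"
      using x0 by (intro mult_right_mono) auto
    then show ?thesis using that by (intro exI[of _ a]) auto
  qed
  have lamle: "lam \<le> m + 1" using lam_le d3 by simp
  show ?thesis
  proof (cases "lam \<le> t1")
    case True
    then show ?thesis using kite[OF dn(1), of t1] end_le_cheb[of t1] t1 m35 by (simp add: t1_def)
  next
    case False
    then have gt: "m < lam" using t1 by linarith
    consider "outside \<inter> E `` {v (d - 2)} \<noteq> {}" | "outside \<inter> E `` {v (d - 2)} = {}" by blast
    then show ?thesis
    proof cases
      case 1
      show ?thesis
        using kite[OF dn(2) early_branch[OF d3 gt 1]] gt m35 lamle t0 by (simp add: t0_def)
    next
      case 2
      have "branch \<noteq> {}"
        using lam_le_kite[OF d3 gt 2] False m35 by (auto simp: t1_def)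
      from late_branch[OF d3 gt 2 this m35] show ?thesis
      proof
        assume "1 \<le> cheb (d - 1) (m + 1) * x (v 0)"
        then show ?thesis using kite[OF dn(2), of "m + 1"] m35 t0 by (simp add: t0_def)
      next
        assume "1 \<le> cheb d m * x (v 0)"
        then show ?thesis using kite[OF dn(1), of m] m35 t1 by (simp add: t1_def)
      qed
    qed
  qed
qed

end

section \<open>Comparison of all graphs with kites\<close>

text \<open>
  The size of \<open>n\<close> is used here: about half of \<open>n\<close> must exceed \<open>2 * 35\<^sup>2\<close>.
\<close>

lemma balanced_kite_bounds:
  assumes n: "5000 \<le> n"
  shows "35 ^ n \<le> principal_ratio (kite n (n div 2))" "real n ^ 2 \<le> principal_ratio (kite n (n div 2))"
proof -
  define a where "a = n div 2"
  define B where "B = real (n - a - 2)"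
  have B: "2498 \<le> B" and nB: "real n \<le> 2 * B + 5" and a: "2500 \<le> a" and na: "n \<le> 2 * a + 1"
    using n by (auto simp: B_def a_def)
  have ratio: "B ^ a \<le> principal_ratio (kite n (n div 2))"
    using ratio_balanced_kite_ge[of n] n by (simp add: B_def a_def)
  have "(35::real) ^ n \<le> 35 ^ (2 * a + 1)" using na by (intro power_increasing) auto
  also have "\<dots> = 35 * (35\<^sup>2) ^ a" by (simp add: power_mult)
  also have "\<dots> \<le> 2 ^ a * (35\<^sup>2) ^ a"
  proof (rule mult_right_mono)
    have "(35::real) \<le> 2 ^ 6" by simp
    also have "\<dots> \<le> 2 ^ a" using a by (intro power_increasing) auto
    finally show "(35::real) \<le> 2 ^ a" .
  qed simp
  also have "\<dots> = 2450 ^ a" by (simp flip: power_mult_distrib)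
  also have "\<dots> \<le> B ^ a" using B by (intro power_mono) auto
  finally show "35 ^ n \<le> principal_ratio (kite n (n div 2))" using ratio by simp
  have "2498 * B \<le> B * B" using B by (intro mult_right_mono) auto
  then have "real n \<le> B * B" using B nB by linarith
  then have "real n \<le> B\<^sup>2" by (simp add: power2_eq_square)
  then have "real n ^ 2 \<le> (B\<^sup>2) ^ 2" by (intro power_mono) auto
  also have "\<dots> = B ^ 4" by (simp flip: power_mult)
  also have "\<dots> \<le> B ^ a" using B a by (intro power_increasing) auto
  finally show "real n ^ 2 \<le> principal_ratio (kite n (n div 2))" using ratio by simp
qed

lemma shortest_walk:
  assumes "(u, w) \<in> E\<^sup>*"
  obtains v d where "v 0 = u" "v d = w" "\<And>i. i < d \<Longrightarrow> (v i, v (Suc i)) \<in> E"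
    "\<And>k. (u, w) \<in> E ^^ k \<Longrightarrow> d \<le> k"
proof -
  define d where "d = (LEAST k. (u, w) \<in> E ^^ k)"
  have "\<exists>k. (u, w) \<in> E ^^ k" using assms by (auto simp: rtrancl_power)
  then have "(u, w) \<in> E ^^ d" unfolding d_def by (rule LeastI_ex)
  then obtain v where "v 0 = u" "v d = w" "\<forall>i<d. (v i, v (Suc i)) \<in> E"
    by (auto simp: relpow_fun_conv)
  then show ?thesis using that[of v d] by (simp add: d_def Least_le)
qed

text \<open>
  When the geodesic is very short, or leaves fewer than \<open>35\<close> vertices outside, the crude bound
  \<open>lam ^ d\<close> on the ratio is already below the ratio of the balanced kite.
\<close>

lemma ratio_le_some_kite:
  assumes n: "5000 \<le> n"
    and G: "pair_graph G" and conn: "Digraph_Component.connected (with_proj G)"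
    and V: "pverts G = {0..<n}"
  shows "\<exists>a<n. principal_ratio G \<le> principal_ratio (kite n a)"
proof -
  let ?V = "{0..<n}" and ?E = "parcs G"
  obtain y where y: "perron ?V ?E y (lambda1 G)"
    and ratio: "principal_ratio G = Max (y ` ?V) / Min (y ` ?V)"
    using principal_ratio_perron[OF G conn V] by metis
  interpret Y: perron ?V ?E y "lambda1 G" by (rule y)
  have ne: "?V \<noteq> {}" using n by auto
  have "Max (y ` ?V) \<in> y ` ?V" "Min (y ` ?V) \<in> y ` ?V" using ne by (auto intro!: Max_in Min_in)
  then obtain w u where w: "w \<in> ?V" "Max (y ` ?V) = y w" and u: "u \<in> ?V" "Min (y ` ?V) = y u"
    by (auto simp: image_iff)
  obtain v d where v: "v 0 = u" "v d = w" "\<And>i. i < d \<Longrightarrow> (v i, v (Suc i)) \<in> ?E"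
    "\<And>k. (u, w) \<in> ?E ^^ k \<Longrightarrow> d \<le> k"
    using shortest_walk[OF connected_rtrancl[OF G conn]] u w V by metis
  define x where "x = (\<lambda>i. inverse (y w) * y i)"
  have yw: "0 < y w" using Y.pos w by simp
  have ymax: "y i \<le> y w" if "i \<in> ?V" for i
    using that w(2)[symmetric] by simp
  interpret perron ?V ?E x "lambda1 G"
    unfolding x_def using yw by (intro Y.scale) simp
  interpret normalised_geodesic ?V ?E x "lambda1 G" v d
  proof
    show "v 0 \<in> ?V" using v u by simp
    show "x (v d) = 1" using v yw by (simp add: x_def)
    show "x i \<le> 1" if "i \<in> ?V" for i using ymax[OF that] yw by (simp add: x_def field_simps)
  qed (use v in auto)
  have x0: "0 < x (v 0)" using pos v0 by simp
  have ratio_x: "principal_ratio G = 1 / x (v 0)"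
    using ratio w u v by (simp add: x_def field_simps)
  have le: "principal_ratio G \<le> c" if "1 \<le> c * x (v 0)" for c
    using that x0 by (simp add: ratio_x field_simps)
  have half: "n div 2 < n" using n by simp
  note balanced = balanced_kite_bounds[OF n]
  have nd: "n = m + d + 1" using card_V by simp
  consider "d = 0" | "1 \<le> d" "d \<le> 2" | "1 \<le> d" "m \<le> 34" | "3 \<le> d" "35 \<le> m" by linarith
  then show ?thesis
  proof cases
    case 1
    have "1 \<le> 1 * x (v 0)" using x_end 1 by simp
    then have "principal_ratio G \<le> 1" by (rule le)
    also have "1 \<le> real n ^ 2" using n by (intro one_le_power) auto
    finally show ?thesis using half balanced(2) by force
  next
    case 2
    have "lambda1 G \<le> n" using lam_le 2 nd by simp
    then have "principal_ratio G \<le> real n ^ d" using end_le_power 2 by (intro le) auto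
    also have "\<dots> \<le> real n ^ 2" using 2 n by (intro power_increasing) auto
    finally show ?thesis using half balanced(2) by force
  next
    case 3
    have "lambda1 G \<le> 35" using lam_le 3 by simp
    then have "principal_ratio G \<le> 35 ^ d" using end_le_power 3 by (intro le) auto
    also have "\<dots> \<le> 35 ^ n" using nd by (intro power_increasing) auto
    finally show ?thesis using half balanced(1) by force
  next
    case 4
    then show ?thesis using end_le_kite le by auto
  qed
qed

theorem theorem1p2:
  fixes n :: nat
  assumes "n \<ge> 5000"
  shows "\<exists>r s :: nat. r \<ge> 1 \<and> s \<ge> 1 \<and> r + s - 1 = n \<and>
    (\<forall>G :: nat pair_pre_digraph.
       pair_graph G \<and> Digraph_Component.connected (with_proj G) \<and> pverts G = {0..<n} \<longrightarrow>
         principal_ratio G \<le> principal_ratio (kite_graph r s))"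
proof -
  let ?R = "(\<lambda>a. principal_ratio (kite n a)) ` {..<n}"
  have "{..<n} \<noteq> {}" using assms by (simp add: lessThan_empty_iff)
  then have "Max ?R \<in> ?R" by (intro Max_in) auto
  then obtain a where a: "a < n" "Max ?R = principal_ratio (kite n a)" by auto
  have best: "principal_ratio (kite n b) \<le> principal_ratio (kite n a)" if "b < n" for b
    using that unfolding a(2)[symmetric] by (intro Max_ge) auto
  show ?thesis
  proof (rule exI[of _ "a + 1"], rule exI[of _ "n - a"], intro conjI allI impI)
    fix G :: "nat pair_pre_digraph"
    assume "pair_graph G \<and> Digraph_Component.connected (with_proj G) \<and> pverts G = {0..<n}"
    then obtain b where "b < n" "principal_ratio G \<le> principal_ratio (kite n b)"
      using ratio_le_some_kite[OF assms] by blast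
    then show "principal_ratio G \<le> principal_ratio (kite_graph (a + 1) (n - a))"
      using best[of b] by (simp add: kite_def)
  qed (use a in auto)
qed

end
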